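(* Let $n\ge1$, $s\in(0,1)$, let $\Omega\subset\mathbb R^n$ be a bounded open set with Lipschitz boundary, and let $f\in L^{\frac ns}(\Omega)$. Let $u\in\mathcal W_0^{s,1}(\Omega)$ be a minimizer of $\mathcal F_1^s$. Then $u\in L^\infty(\mathbb R^n)$ and the set of extremal points $$\{x\in\mathbb R^n\ :\ |u(x)|=\|u\|_{L^\infty(\mathbb R^n)}\}$$ has positive Lebesgue measure.
   Context: $\mathcal W^{s,1}_0(\Omega)$ is the closure of $C_c^\infty(\Omega)$ in the norm $\|u\|_{W^{s,1}(\Omega)}=\|u\|_{L^1(\Omega)}+\int_\Omega\int_\Omega\frac{|u(x)-u(y)|}{|x-y|^{n+s}}dxdy$, its elements being functions on $\mathbb R^n$ vanishing on $\mathbb R^n\setminus\Omega$ (for Lipschitz bounded $\Omega$ it equals the set of all $u:\mathbb R^n\to\mathbb R$ with $u=0$ on $\mathbb R^n\setminus\Omega$ and finite norm). $\mathcal F_1^s(u)=\frac12\iint_{\mathbb R^{2n}}\frac{|u(x)-u(y)|}{|x-y|^{n+s}}dxdy-\int_\Omega fu\,dx$. A minimizer of $\mathcal F_1^s$ is a $u\in\mathcal W_0^{s,1}(\Omega)$ with $\mathcal F_1^s(u)\le\mathcal F_1^s(v)$ for all $v\in\mathcal W_0^{s,1}(\Omega)$. *)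

theory Defs
  imports "HOL-Analysis.Analysis" "HOL-Probability.Essential_Supremum"
begin

text \<open>Near every boundary point, after a rotation taking the last coordinate axis to \<open>e\<close>, the set
  is the strict supergraph of a Lipschitz function of the remaining coordinates. The hyperplane
  \<open>{z. z \<bullet> e = 0}\<close> plays the role of the space of the remaining coordinates. In dimension one it
  is \<open>{0}\<close>, so that the set is locally an open half-line.\<close>

definition lipschitz_boundary :: "'a::euclidean_space set \<Rightarrow> bool" where
  "lipschitz_boundary \<Omega> \<longleftrightarrow>
     (\<forall>p\<in>frontier \<Omega>. \<exists>r>0. \<exists>e. \<exists>\<gamma>::'a \<Rightarrow> real. \<exists>L.
        norm e = 1 \<and> L-lipschitz_on {z. z \<bullet> e = 0} \<gamma> \<and>
        \<Omega> \<inter> ball p r = {x \<in> ball p r. x \<bullet> e > \<gamma> (x - (x \<bullet> e) *\<^sub>R e)})"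

primrec C_k :: "nat \<Rightarrow> ('a::euclidean_space \<Rightarrow> real) \<Rightarrow> bool" where
  "C_k 0 \<phi> \<longleftrightarrow> continuous_on UNIV \<phi>"
| "C_k (Suc k) \<phi> \<longleftrightarrow> \<phi> differentiable_on UNIV \<and>
     (\<forall>b\<in>Basis. C_k k (\<lambda>x. frechet_derivative \<phi> (at x) b))"

definition Cc_infinity :: "'a::euclidean_space set \<Rightarrow> ('a \<Rightarrow> real) set" where
  "Cc_infinity \<Omega> = {\<phi>. (\<forall>k. C_k k \<phi>) \<and>
     compact (closure {x. \<phi> x \<noteq> 0}) \<and> closure {x. \<phi> x \<noteq> 0} \<subseteq> \<Omega>}"

text \<open>The integrand is \<open>0\<close> on the diagonal, by the convention for division by zero.\<close>

definition gagliardo :: "real \<Rightarrow> 'a::euclidean_space set \<Rightarrow> ('a \<Rightarrow> real) \<Rightarrow> ennreal" where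
  "gagliardo s A u = (\<integral>\<^sup>+x\<in>A. (\<integral>\<^sup>+y\<in>A.
     ennreal (\<bar>u x - u y\<bar> / norm (x - y) powr (real DIM('a) + s)) \<partial>lebesgue) \<partial>lebesgue)"

definition Ws1_norm :: "real \<Rightarrow> 'a::euclidean_space set \<Rightarrow> ('a \<Rightarrow> real) \<Rightarrow> ennreal" where
  "Ws1_norm s \<Omega> u = (\<integral>\<^sup>+x\<in>\<Omega>. ennreal \<bar>u x\<bar> \<partial>lebesgue) + gagliardo s \<Omega> u"

text \<open>Elements are measurable representatives. Vanishing outside \<open>\<Omega>\<close> is required almost everywhere
  only, so that membership depends only on the almost-everywhere class. The closure condition
  forces the norm of \<open>u\<close> to be finite.\<close>

definition Ws1_zero :: "real \<Rightarrow> 'a::euclidean_space set \<Rightarrow> ('a \<Rightarrow> real) set" where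
  "Ws1_zero s \<Omega> = {u. u \<in> borel_measurable lebesgue \<and>
     (AE x in lebesgue. x \<notin> \<Omega> \<longrightarrow> u x = 0) \<and>
     (\<forall>\<epsilon>>0. \<exists>\<phi>\<in>Cc_infinity \<Omega>. Ws1_norm s \<Omega> (\<lambda>x. u x - \<phi> x) < \<epsilon>)}"

definition Lp_on :: "real \<Rightarrow> 'a::euclidean_space set \<Rightarrow> ('a \<Rightarrow> real) set" where
  "Lp_on p A = {f. f \<in> borel_measurable (lebesgue_on A) \<and>
     integrable (lebesgue_on A) (\<lambda>x. \<bar>f x\<bar> powr p)}"

definition Linf_norm :: "('a::euclidean_space \<Rightarrow> real) \<Rightarrow> ereal" where
  "Linf_norm u = esssup lebesgue (\<lambda>x. ereal \<bar>u x\<bar>)"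

definition Linf :: "('a::euclidean_space \<Rightarrow> real) set" where
  "Linf = {u. u \<in> borel_measurable lebesgue \<and> Linf_norm u < \<infinity>}"

text \<open>The functional is extended-real valued, so that an infinite seminorm is not silently read as \<open>0\<close>.
  The linear term is a Bochner integral. For \<open>f\<close> in \<open>L\<^sup>p(\<Omega>)\<close> with \<open>p = n/s\<close> and \<open>\<Omega>\<close> bounded with Lipschitz
  boundary, the product \<open>f u\<close> is integrable for every \<open>u\<close> in \<open>Ws1_zero s \<Omega>\<close>, by the fractional
  Sobolev embedding.\<close>

definition F1 ::
  "real \<Rightarrow> 'a::euclidean_space set \<Rightarrow> ('a \<Rightarrow> real) \<Rightarrow> ('a \<Rightarrow> real) \<Rightarrow> ereal" where
  "F1 s \<Omega> f u = ereal (1/2) * enn2ereal (gagliardo s UNIV u) - ereal (LINT x:\<Omega>|lebesgue. f x * u x)"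

definition F1_minimizer ::
  "real \<Rightarrow> 'a::euclidean_space set \<Rightarrow> ('a \<Rightarrow> real) \<Rightarrow> ('a \<Rightarrow> real) \<Rightarrow> bool" where
  "F1_minimizer s \<Omega> f u \<longleftrightarrow>
     u \<in> Ws1_zero s \<Omega> \<and> (\<forall>v\<in>Ws1_zero s \<Omega>. F1 s \<Omega> f u \<le> F1 s \<Omega> f v)"

end

theory Submission
  imports Defs
begin

text \<open>
The idea is to compare the minimizer \<open>u\<close> with what is left of it after cutting off its values above a
height \<open>k\<close>. Write \<open>w = G(u)\<close>, where \<open>G\<close> is odd, vanishes exactly on \<open>[-k, k]\<close>, and both \<open>G\<close> and
\<open>t \<mapsto> t - G t\<close> are nondecreasing. Because of this monotonicity no cancellation occurs in
\<open>\<bar>u x - u y\<bar> = \<bar>(u - w) x - (u - w) y\<bar> + \<bar>w x - w y\<bar>\<close>, so the seminorm of \<open>u\<close> is exactly the sum of those of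
\<open>u - w\<close> and \<open>w\<close> (\<open>gagliardo_excess_split\<close>). Minimality against the competitor \<open>u - w\<close> therefore reads
\<open>[w] / 2 \<le> \<integral> f w\<close>.

In the other direction, a weighted fractional Sobolev inequality (\<open>weighted_sobolev\<close>) says
\<open>\<integral> \<bar>f w\<bar> \<le> C \<parallel>f\<parallel> [w]\<close>, with the norm of \<open>f\<close> in \<open>L\<^sup>p\<close>, \<open>p = n/s\<close>, taken only over the
set \<open>{\<bar>u\<bar> > k}\<close> where \<open>w \<noteq> 0\<close>. As soon as this norm is below a fixed threshold the two inequalities force
\<open>[w] = 0\<close>, hence \<open>w = 0\<close> and \<open>\<bar>u\<bar> \<le> k\<close> almost everywhere (\<open>minimizer_excess_vanishes\<close>).

Both claims follow by letting \<open>k\<close> vary. The sets \<open>{\<bar>u\<bar> > k}\<close> shrink to the empty set as \<open>k \<rightarrow> \<infinity>\<close>, so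
some \<open>k\<close> works and \<open>u\<close> is bounded. If \<open>m\<close>, the essential supremum of \<open>\<bar>u\<bar>\<close>, were positive and attained
only on a null set, then \<open>{\<bar>u\<bar> > k}\<close> would shrink to a null set as \<open>k\<close> increases to \<open>m\<close>, so some \<open>k < m\<close>
would work, which contradicts the choice of \<open>m\<close>. If \<open>m = 0\<close>, the extremal set is conull.

The Sobolev inequality is obtained by slicing along the level sets of \<open>\<bar>w\<bar>\<close>, which reduces it to an isoperimetric
inequality for the fractional perimeter, and this one holds even pointwise (\<open>isoperimetric_pointwise\<close>).
The competitor \<open>u - w\<close> has to be a limit of test functions. This is why \<open>G\<close> is built from
\<open>exp (- 1 / t)\<close> rather than being piecewise linear: composing a test function with the smooth map \<open>t \<mapsto> t - G t\<close>
gives a test function again, and no mollification is required (\<open>Ws1_zero_compose\<close>).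
\<close>

section \<open>A flat smooth function\<close>

text \<open>The sequence of all iterated derivatives is kept as the witness, since an induction on the order of
  differentiability of a composition meets each of them.\<close>

definition smooth_real :: "(real \<Rightarrow> real) \<Rightarrow> bool" where
  "smooth_real g \<longleftrightarrow>
     (\<exists>D. D 0 = g \<and> (\<forall>n x. (D n has_real_derivative D (Suc n) x) (at x)))"

lemma smooth_real_ident: "smooth_real (\<lambda>t. t)"
proof -
  define D :: "nat \<Rightarrow> real \<Rightarrow> real"
    where "D n t = (if n = 0 then t else if n = 1 then 1 else 0)" for n t
  have "(D n has_real_derivative D (Suc n) x) (at x)" for n x
    unfolding D_def by (cases n) (auto intro!: derivative_eq_intros)
  moreover have "D 0 = (\<lambda>t. t)" by (simp add: D_def fun_eq_iff)
  ultimately show ?thesis unfolding smooth_real_def by blast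
qed

lemma smooth_real_diff:
  assumes "smooth_real f" "smooth_real g"
  shows "smooth_real (\<lambda>t. f t - g t)"
proof -
  obtain D E where
    "D 0 = f" "\<And>n x. (D n has_real_derivative D (Suc n) x) (at x)"
    "E 0 = g" "\<And>n x. (E n has_real_derivative E (Suc n) x) (at x)"
    using assms unfolding smooth_real_def by metis
  then show ?thesis
    unfolding smooth_real_def
    by (intro exI[of _ "\<lambda>n t. D n t - E n t"]) (auto intro!: DERIV_diff)
qed

lemma smooth_real_affine:
  assumes "smooth_real f"
  shows "smooth_real (\<lambda>t. f (a * t + b))"
proof -
  obtain D where D: "D 0 = f" "\<And>n x. (D n has_real_derivative D (Suc n) x) (at x)"
    using assms unfolding smooth_real_def by metis
  have "((\<lambda>t. a ^ n * D n (a * t + b)) has_real_derivative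
      a ^ Suc n * D (Suc n) (a * x + b)) (at x)" for n x
  proof -
    have "((\<lambda>t. D n (a * t + b)) has_real_derivative D (Suc n) (a * x + b) * a) (at x)"
      by (rule DERIV_chain2[OF D(2)]) (auto intro!: derivative_eq_intros)
    from DERIV_cmult[OF this, of "a ^ n"] show ?thesis by (simp add: mult_ac)
  qed
  then show ?thesis
    unfolding smooth_real_def
    by (intro exI[of _ "\<lambda>n t. a ^ n * D n (a * t + b)"]) (auto simp: D(1))
qed

text \<open>The standard smooth function that vanishes exactly on the closed negative half-line.\<close>

definition flat_exp :: "real \<Rightarrow> real" where
  "flat_exp t = (if t \<le> 0 then 0 else exp (- (1 / t)))"

lemma poly_exp_tendsto_0: "((\<lambda>y. poly p y * exp (- y)) \<longlongrightarrow> (0::real)) at_top"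
proof -
  have "((\<lambda>y. coeff p i * (y ^ i / exp y)) \<longlongrightarrow> coeff p i * 0) at_top" for i
    by (intro tendsto_intros tendsto_power_div_exp_0)
  then have "((\<lambda>y. \<Sum>i\<le>degree p. coeff p i * (y ^ i / exp y)) \<longlongrightarrow> (\<Sum>i\<le>degree p. 0)) at_top"
    by (intro tendsto_sum) simp
  then show ?thesis
    by (simp add: poly_altdef sum_distrib_right exp_minus divide_inverse mult.assoc)
qed

text \<open>Functions of the form \<open>P(1/t) exp (- 1/t)\<close>, extended by zero, are closed under differentiation, which is
  how all derivatives of \<open>flat_exp\<close> are produced at once. At the origin the difference quotient tends to zero
  because, in terms of \<open>y = 1/t\<close>, the exponential beats every polynomial.\<close>

lemma DERIV_poly_flat_exp:
  fixes p :: "real poly"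
  defines "q \<equiv> [:0, 0, 1:] * (p - pderiv p)"
  shows "((\<lambda>t. poly p (1 / t) * flat_exp t) has_real_derivative
     poly q (1 / x) * flat_exp x) (at x)"
proof -
  consider "x < 0" | "x = 0" | "x > 0" by linarith
  then show ?thesis
  proof cases
    case 1
    have "((\<lambda>t. 0) has_real_derivative 0) (at x)" by simp
    then have "((\<lambda>t. poly p (1 / t) * flat_exp t) has_real_derivative 0) (at x)"
      by (rule has_field_derivative_transform_within_open[of _ _ _ "{..<0}"])
         (use 1 in \<open>auto simp: flat_exp_def\<close>)
    then show ?thesis using 1 by (simp add: flat_exp_def)
  next
    case 3
    have "((\<lambda>t. poly p (1 / t) * exp (- (1 / t))) has_real_derivative
        poly q (1 / x) * exp (- (1 / x))) (at x)"
      unfolding q_def using 3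
      by (auto intro!: derivative_eq_intros DERIV_chain2[OF poly_DERIV]
          simp: field_simps power2_eq_square)
    then have "((\<lambda>t. poly p (1 / t) * flat_exp t) has_real_derivative
        poly q (1 / x) * exp (- (1 / x))) (at x)"
      by (rule has_field_derivative_transform_within_open[of _ _ _ "{0<..}"])
         (use 3 in \<open>auto simp: flat_exp_def\<close>)
    then show ?thesis using 3 by (simp add: flat_exp_def)
  next
    case 2
    have "((\<lambda>h. poly p (1 / h) * flat_exp h / h) \<longlongrightarrow> 0) (at_right 0)"
    proof -
      have "((\<lambda>h. poly (pCons 0 p) (inverse h) * exp (- inverse h)) \<longlongrightarrow> 0) (at_right (0::real))"
        by (rule filterlim_compose[OF poly_exp_tendsto_0 filterlim_inverse_at_top_right])
      then show ?thesis
        by (rule Lim_transform_eventually)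
           (auto simp: eventually_at_filter flat_exp_def field_simps)
    qed
    moreover have "((\<lambda>h. poly p (1 / h) * flat_exp h / h) \<longlongrightarrow> 0) (at_left 0)"
      by (rule Lim_transform_eventually[OF tendsto_const])
         (auto simp: eventually_at_filter flat_exp_def)
    ultimately have "((\<lambda>h. poly p (1 / h) * flat_exp h / h) \<longlongrightarrow> 0) (at 0)"
      by (simp add: filterlim_at_split)
    then show ?thesis unfolding DERIV_def 2 by (simp add: flat_exp_def)
  qed
qed

lemma smooth_real_flat_exp: "smooth_real flat_exp"
proof -
  define P :: "nat \<Rightarrow> real poly"
    where "P n = ((\<lambda>p. [:0, 0, 1:] * (p - pderiv p)) ^^ n) 1" for n
  have "((\<lambda>t. poly (P n) (1 / t) * flat_exp t) has_real_derivative
     poly (P (Suc n)) (1 / x) * flat_exp x) (at x)" for n x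
    using DERIV_poly_flat_exp[of "P n" x] by (simp only: P_def funpow.simps o_apply)
  then show ?thesis
    unfolding smooth_real_def
    by (intro exI[of _ "\<lambda>n t. poly (P n) (1 / t) * flat_exp t"]) (auto simp: P_def)
qed

text \<open>With \<open>y = 1/x\<close> the derivative is \<open>y\<^sup>2 exp (- y)\<close>, so the upper bound is \<open>y\<^sup>2 \<le> exp y\<close>, the square of
  \<open>2 z \<le> exp z\<close> at \<open>z = y/2\<close>.\<close>

lemma flat_exp_DERIV_bounds:
  "\<exists>d. (flat_exp has_real_derivative d) (at x) \<and> 0 \<le> d \<and> d \<le> 1"
proof -
  have "(flat_exp has_real_derivative (1 / x)\<^sup>2 * flat_exp x) (at x)"
    using DERIV_poly_flat_exp[of 1 x] by (simp add: power2_eq_square)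
  moreover have "(1 / x)\<^sup>2 * flat_exp x \<le> 1"
  proof (cases "x > 0")
    case True
    define z where "z = 1 / x / 2"
    have z: "z \<ge> 0" using True by (simp add: z_def)
    have "2 * z \<le> 1 + z + z\<^sup>2 / 2"
      using zero_le_power2[of "z - 1"] by (simp add: power2_eq_square algebra_simps)
    also have "\<dots> \<le> exp z" by (rule exp_lower_Taylor_quadratic[OF z])
    finally have "(2 * z)\<^sup>2 \<le> (exp z)\<^sup>2" using z by (intro power_mono) auto
    also have "(exp z)\<^sup>2 = exp (2 * z)" by (simp add: exp_double)
    finally have "(2 * z)\<^sup>2 * exp (- (2 * z)) \<le> 1" by (simp add: exp_minus field_simps)
    then show ?thesis using True by (simp add: z_def flat_exp_def)
  qed (simp add: flat_exp_def)
  ultimately show ?thesis by (intro exI conjI) (auto simp: flat_exp_def)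
qed

lemma flat_exp_mono: "a \<le> b \<Longrightarrow> flat_exp a \<le> flat_exp b"
  by (rule DERIV_nonneg_imp_nondecreasing) (use flat_exp_DERIV_bounds in blast)+

lemma flat_exp_nonexpansive:
  assumes "a \<le> b" shows "flat_exp b - flat_exp a \<le> b - a"
proof -
  have "\<exists>y. ((\<lambda>x. x - flat_exp x) has_real_derivative y) (at x) \<and> 0 \<le> y" for x
  proof -
    obtain d where d: "(flat_exp has_real_derivative d) (at x)" "d \<le> 1"
      using flat_exp_DERIV_bounds by blast
    have "((\<lambda>x. x - flat_exp x) has_real_derivative 1 - d) (at x)"
      by (rule DERIV_diff[OF DERIV_ident d(1)])
    then show ?thesis using d(2) by (intro exI[of _ "1 - d"]) simp
  qed
  from DERIV_nonneg_imp_nondecreasing[OF assms this] show ?thesis by simp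
qed

section \<open>Test functions under smooth composition\<close>

lemma C_k_pred: "C_k (Suc k) \<phi> \<Longrightarrow> C_k k \<phi>"
proof (induction k arbitrary: \<phi>)
  case 0
  then show ?case by (simp add: differentiable_imp_continuous_on)
qed simp

lemma C_k_add: "C_k k \<phi> \<Longrightarrow> C_k k \<eta> \<Longrightarrow> C_k k (\<lambda>x. \<phi> x + \<eta> x)"
proof (induction k arbitrary: \<phi> \<eta>)
  case 0
  then show ?case by (simp add: continuous_on_add)
next
  case (Suc k)
  have "(\<lambda>x. frechet_derivative (\<lambda>x. \<phi> x + \<eta> x) (at x) b) =
     (\<lambda>x. frechet_derivative \<phi> (at x) b + frechet_derivative \<eta> (at x) b)" for b
  proof
    fix x
    have "((\<lambda>x. \<phi> x + \<eta> x) has_derivative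
       (\<lambda>h. frechet_derivative \<phi> (at x) h + frechet_derivative \<eta> (at x) h)) (at x)"
      using Suc.prems
      by (intro has_derivative_add) (auto simp: differentiable_on_def frechet_derivative_works)
    from frechet_derivative_at[OF this, symmetric]
    show "frechet_derivative (\<lambda>x. \<phi> x + \<eta> x) (at x) b =
      frechet_derivative \<phi> (at x) b + frechet_derivative \<eta> (at x) b"
      by (rule fun_cong)
  qed
  then show ?case using Suc by (auto simp: differentiable_on_def)
qed

lemma C_k_mult: "C_k k \<phi> \<Longrightarrow> C_k k \<eta> \<Longrightarrow> C_k k (\<lambda>x. \<phi> x * \<eta> x)"
proof (induction k arbitrary: \<phi> \<eta>)
  case 0
  then show ?case by (simp add: continuous_on_mult)
next
  case (Suc k)
  have d: "(\<lambda>x. frechet_derivative (\<lambda>x. \<phi> x * \<eta> x) (at x) b) =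
     (\<lambda>x. \<phi> x * frechet_derivative \<eta> (at x) b + frechet_derivative \<phi> (at x) b * \<eta> x)" for b
  proof
    fix x
    have "((\<lambda>x. \<phi> x * \<eta> x) has_derivative (\<lambda>h. \<phi> x * frechet_derivative \<eta> (at x) h
       + frechet_derivative \<phi> (at x) h * \<eta> x)) (at x)"
      using Suc.prems
      by (intro has_derivative_mult) (auto simp: differentiable_on_def frechet_derivative_works)
    from frechet_derivative_at[OF this, symmetric]
    show "frechet_derivative (\<lambda>x. \<phi> x * \<eta> x) (at x) b =
      \<phi> x * frechet_derivative \<eta> (at x) b + frechet_derivative \<phi> (at x) b * \<eta> x"
      by (rule fun_cong)
  qed
  have "C_k k \<phi>" "C_k k \<eta>" using Suc.prems by (auto intro: C_k_pred)
  then show ?case using Suc.prems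
    by (auto simp: d differentiable_on_def intro!: C_k_add Suc.IH)
qed

text \<open>By the chain rule each partial derivative is \<open>D (n + 1) \<circ> \<phi>\<close> times a partial derivative of \<open>\<phi>\<close>. Stating the
  lemma for all \<open>n\<close> together lets the induction on \<open>k\<close> absorb the first factor.\<close>

lemma C_k_compose:
  assumes D: "\<And>n x. (D n has_real_derivative D (Suc n) x) (at x)"
  shows "C_k k \<phi> \<Longrightarrow> C_k k (\<lambda>x. D n (\<phi> x))"
proof (induction k arbitrary: n \<phi>)
  case 0
  have "continuous_on UNIV (D n)"
    using D by (meson DERIV_isCont continuous_at_imp_continuous_on)
  with 0 show ?case by (auto intro: continuous_on_compose2)
next
  case (Suc k)
  have d: "((\<lambda>x. D n (\<phi> x)) has_derivative
     (\<lambda>h. D (Suc n) (\<phi> x) * frechet_derivative \<phi> (at x) h)) (at x)" for x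
  proof -
    have "(\<phi> has_derivative frechet_derivative \<phi> (at x)) (at x)"
      using Suc.prems by (auto simp: differentiable_on_def frechet_derivative_works)
    from has_derivative_compose[OF this D[of n "\<phi> x", unfolded has_field_derivative_def]]
    show ?thesis .
  qed
  have "(\<lambda>x. frechet_derivative (\<lambda>x. D n (\<phi> x)) (at x) b) =
     (\<lambda>x. D (Suc n) (\<phi> x) * frechet_derivative \<phi> (at x) b)" for b
    by (rule ext, subst frechet_derivative_at[OF d, symmetric]) (rule refl)
  moreover have "(\<lambda>x. D n (\<phi> x)) differentiable_on UNIV"
    using d by (auto simp: differentiable_on_def differentiable_def)
  moreover have "C_k k \<phi>" by (rule C_k_pred[OF Suc.prems])
  ultimately show ?case
    using Suc.prems by (auto intro!: C_k_mult Suc.IH)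
qed

lemma Cc_infinity_compose:
  assumes "smooth_real \<Phi>" "\<Phi> 0 = 0" "\<phi> \<in> Cc_infinity \<Omega>"
  shows "(\<lambda>x. \<Phi> (\<phi> x)) \<in> Cc_infinity \<Omega>"
proof -
  obtain D where D: "D 0 = \<Phi>" "\<And>n x. (D n has_real_derivative D (Suc n) x) (at x)"
    using assms unfolding smooth_real_def by metis
  have "closure {x. \<Phi> (\<phi> x) \<noteq> 0} \<subseteq> closure {x. \<phi> x \<noteq> 0}"
    using assms(2) by (intro closure_mono) auto
  moreover from this have "compact (closure {x. \<Phi> (\<phi> x) \<noteq> 0})"
    using assms(3) unfolding Cc_infinity_def
    by (metis (no_types, lifting) mem_Collect_eq closed_closure closed_Int_compact inf.absorb_iff1)
  moreover have "C_k k (\<lambda>x. \<Phi> (\<phi> x))" for k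
    using C_k_compose[of D k \<phi> 0, OF D(2)] assms(3) by (simp add: D(1) Cc_infinity_def)
  ultimately show ?thesis using assms(3) by (auto simp: Cc_infinity_def)
qed

section \<open>The seminorm as an integral over a product\<close>

interpretation lebesgue: sigma_finite_measure lebesgue
proof
  obtain A :: "'a set set" where A: "countable A" "A \<subseteq> sets lborel" "\<Union>A = space lborel"
      "\<forall>a\<in>A. emeasure lborel a \<noteq> \<infinity>"
    using lborel.sigma_finite_countable by blast
  have "a \<in> sets lebesgue \<and> emeasure lebesgue a \<noteq> \<infinity>" if "a \<in> A" for a
  proof -
    have "a \<in> sets lborel" using A that by blast
    then have "a \<in> sets lebesgue" "emeasure lebesgue a = emeasure lborel a"
      by (auto simp: emeasure_completion main_part_sets)
    then show ?thesis using A that by simp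
  qed
  moreover have "\<Union>A = space lebesgue" using A by simp
  ultimately show "\<exists>A. countable A \<and> A \<subseteq> sets (lebesgue :: 'a measure) \<and>
      \<Union>A = space lebesgue \<and> (\<forall>a\<in>A. emeasure lebesgue a \<noteq> \<infinity>)"
    using A(1) by blast
qed

definition gagliardo_kernel :: "real \<Rightarrow> 'a::euclidean_space \<Rightarrow> 'a \<Rightarrow> real" where
  "gagliardo_kernel s x y = 1 / norm (x - y) powr (real DIM('a) + s)"

lemma gagliardo_kernel_nonneg [simp]: "0 \<le> gagliardo_kernel s x y"
  by (simp add: gagliardo_kernel_def)

lemma borel_measurable_lebesgueI: "f \<in> borel_measurable borel \<Longrightarrow> f \<in> borel_measurable lebesgue"
  by (rule measurable_completion) simp

lemma gagliardo_kernel_measurable [measurable (raw)]: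
  fixes f g :: "'b \<Rightarrow> 'a::euclidean_space"
  assumes f: "f \<in> measurable N lebesgue" and g: "g \<in> measurable N lebesgue"
  shows "(\<lambda>z. gagliardo_kernel s (f z) (g z)) \<in> borel_measurable N"
proof -
  have id: "(\<lambda>x. x) \<in> borel_measurable (lebesgue :: 'a measure)"
    by (rule borel_measurable_lebesgueI) simp
  have [measurable]: "f \<in> borel_measurable N" "g \<in> borel_measurable N"
    using measurable_compose[OF f id] measurable_compose[OF g id] by simp_all
  show ?thesis unfolding gagliardo_kernel_def by measurable
qed

interpretation lebesgue_pair: pair_sigma_finite
    "lebesgue :: 'a::euclidean_space measure" "lebesgue :: 'b::euclidean_space measure" ..

interpretation lborel_lebesgue_pair: pair_sigma_finite
    "lborel :: real measure" "lebesgue :: 'b::euclidean_space measure" ..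

lemma gagliardo_eq_nn_integral_pair:
  fixes u :: "'a::euclidean_space \<Rightarrow> real"
  assumes [measurable]: "u \<in> borel_measurable lebesgue" "A \<in> sets lebesgue"
  shows "gagliardo s A u = (\<integral>\<^sup>+z. ennreal (\<bar>u (fst z) - u (snd z)\<bar> *
     gagliardo_kernel s (fst z) (snd z)) * indicator (A \<times> A) z \<partial>(lebesgue \<Otimes>\<^sub>M lebesgue))"
proof -
  have "gagliardo s A u = (\<integral>\<^sup>+x. \<integral>\<^sup>+y. ennreal (\<bar>u x - u y\<bar> * gagliardo_kernel s x y) *
      indicator (A \<times> A) (x, y) \<partial>lebesgue \<partial>lebesgue)"
    unfolding gagliardo_def gagliardo_kernel_def
    by (intro nn_integral_cong) (auto simp: indicator_def)
  also have "\<dots> = (\<integral>\<^sup>+z. ennreal (\<bar>u (fst z) - u (snd z)\<bar> *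
     gagliardo_kernel s (fst z) (snd z)) * indicator (A \<times> A) z \<partial>(lebesgue \<Otimes>\<^sub>M lebesgue))"
    by (subst lebesgue.nn_integral_fst[symmetric]) (auto simp: indicator_def)
  finally show ?thesis .
qed

section \<open>A weighted fractional Sobolev inequality\<close>

text \<open>Take the ball around \<open>x\<close> of twice the measure of \<open>A\<close>. At least half of it lies outside \<open>A\<close>, and on that part
  the kernel is at least its value at the radius of the ball. Integrating over \<open>x \<in> A\<close> yields the isoperimetric
  inequality \<open>\<bar>A\<bar> powr (1 - s/n) \<le> C Per\<^sub>s A\<close> for the fractional perimeter.\<close>

lemma isoperimetric_pointwise:
  fixes s :: real
  assumes "0 < s"
  obtains C where "0 < C"
    and "\<And>(A :: 'a::euclidean_space set) a x. A \<in> sets lebesgue \<Longrightarrow> 0 < a \<Longrightarrow>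
      emeasure lebesgue A = ennreal a \<Longrightarrow>
      ennreal (a powr (- s / DIM('a))) \<le>
        ennreal C * (\<integral>\<^sup>+y. ennreal (gagliardo_kernel s x y) * indicator (- A) y \<partial>lebesgue)"
proof -
  define n where "n = real DIM('a)"
  define \<omega> where "\<omega> = unit_ball_vol n"
  have n: "n > 0" and \<omega>: "\<omega> > 0" by (auto simp: n_def \<omega>_def)
  define C where "C = (2 / \<omega>) powr (1 + s / n)"
  show thesis
  proof (rule that[of C])
    show "0 < C" using \<omega> by (simp add: C_def)
  next
    fix A :: "'a set" and a :: real and x :: 'a
    assume A[measurable]: "A \<in> sets lebesgue" and a: "0 < a" and Aa: "emeasure lebesgue A = ennreal a"
    define r where "r = (2 * a / \<omega>) powr (1 / n)"
    have r: "r > 0" using a \<omega> by (simp add: r_def)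
    have "r ^ DIM('a) = 2 * a / \<omega>"
      using a \<omega> n r by (simp add: r_def n_def powr_realpow[symmetric] powr_powr)
    then have "\<omega> * r ^ DIM('a) = 2 * a" using \<omega> by simp
    moreover have "emeasure lebesgue (ball x r) = ennreal (\<omega> * r ^ DIM('a))"
      using r by (simp add: emeasure_ball \<omega>_def n_def)
    ultimately have ball: "emeasure lebesgue (ball x r) = ennreal (2 * a)" by simp
    \<comment> \<open>The center is removed because the kernel is \<open>0\<close> there, by
      division by zero.\<close>
    define B where "B = ball x r - A - {x}"
    have X: "{x} \<in> sets lebesgue" by simp
    have Bm: "B \<in> sets lebesgue"
      unfolding B_def by (intro sets.Diff A X) auto
    have "ball x r \<subseteq> B \<union> (A \<union> {x})" by (auto simp: B_def)
    then have "emeasure lebesgue (ball x r) \<le> emeasure lebesgue (B \<union> (A \<union> {x}))"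
      by (intro emeasure_mono sets.Un Bm A X)
    also have "\<dots> \<le> emeasure lebesgue B + emeasure lebesgue (A \<union> {x})"
      by (intro emeasure_subadditive sets.Un Bm A X)
    also have "emeasure lebesgue (A \<union> {x}) \<le> emeasure lebesgue A + emeasure lebesgue {x}"
      by (intro emeasure_subadditive A X)
    finally have "ennreal (2 * a) \<le> emeasure lebesgue B + ennreal a"
      by (simp add: ball Aa add_left_mono)
    then have "ennreal a + ennreal a \<le> emeasure lebesgue B + ennreal a"
      using a by (simp flip: ennreal_plus)
    then have B: "ennreal a \<le> emeasure lebesgue B"
      by (simp add: ennreal_add_left_cancel_le add.commute)
    have K: "r powr (- (n + s)) \<le> gagliardo_kernel s x y" if "y \<in> B" for y
    proof -
      have "0 < norm (x - y)" "norm (x - y) < r" using that by (auto simp: B_def dist_norm)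
      then have "norm (x - y) powr (n + s) \<le> r powr (n + s)" "0 < norm (x - y) powr (n + s)"
        using n assms by (auto intro: powr_mono2)
      then show ?thesis
        unfolding gagliardo_kernel_def n_def[symmetric] powr_minus_divide
        by (intro divide_left_mono) (use r in auto)
    qed
    have "a powr (- s / n) = C * r powr (- (n + s)) * a"
    proof -
      have "r powr (- (n + s)) = (2 * a / \<omega>) powr (- (1 + s / n))"
      proof -
        have "1 / n * - (n + s) = - (1 + s / n)" using n by (simp add: field_simps)
        then show ?thesis by (simp only: r_def powr_powr)
      qed
      also have "\<dots> = (2 / \<omega>) powr (- (1 + s / n)) * a powr (- (1 + s / n))"
        using a \<omega> by (subst powr_mult[symmetric]) auto
      finally have r_eq: "r powr (- (n + s)) =
          (2 / \<omega>) powr (- (1 + s / n)) * a powr (- (1 + s / n))" .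
      have "C * (2 / \<omega>) powr (- (1 + s / n)) = 1"
        unfolding C_def using \<omega> by (subst powr_add[symmetric]) simp
      then have "C * r powr (- (n + s)) * a = a powr (- (1 + s / n)) * a powr 1"
        using a by (simp only: r_eq mult.assoc[symmetric]) simp
      also have "\<dots> = a powr (- s / n)"
        by (subst powr_add[symmetric]) simp
      finally show ?thesis by simp
    qed
    then have "ennreal (a powr (- s / n)) = ennreal C * (ennreal (r powr (- (n + s))) * ennreal a)"
      using a \<omega> by (simp add: ennreal_mult mult.assoc C_def)
    also have "\<dots> \<le> ennreal C * (ennreal (r powr (- (n + s))) * emeasure lebesgue B)"
      by (intro mult_left_mono B) auto
    also have "\<dots> = ennreal C * (\<integral>\<^sup>+y. ennreal (r powr (- (n + s))) * indicator B y \<partial>lebesgue)"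
      using Bm by (simp add: nn_integral_cmult_indicator)
    also have "\<dots> \<le> ennreal C * (\<integral>\<^sup>+y. ennreal (gagliardo_kernel s x y) * indicator (- A) y \<partial>lebesgue)"
    proof (intro mult_left_mono nn_integral_mono)
      fix y
      show "ennreal (r powr (- (n + s))) * indicator B y \<le>
          ennreal (gagliardo_kernel s x y) * indicator (- A) y"
      proof (cases "y \<in> B")
        case True
        then have "y \<notin> A" by (simp add: B_def)
        then show ?thesis using True ennreal_leI[OF K[OF True]] by simp
      qed simp
    qed simp
    finally show "ennreal (a powr (- s / DIM('a))) \<le>
        ennreal C * (\<integral>\<^sup>+y. ennreal (gagliardo_kernel s x y) * indicator (- A) y \<partial>lebesgue)"
      by (simp add: n_def)
  qed
qed

text \<open>This is the Hoelder inequality against an indicator, up to the factor \<open>2\<close>. It follows from the elementary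
  bound \<open>g \<le> l + l powr (1 - p) * g powr p\<close>, valid for every \<open>l > 0\<close>; the \<open>l\<close> in the proof makes both terms
  contribute equally.\<close>

lemma nn_integral_le_powr_measure:
  fixes g :: "'a \<Rightarrow> real"
  assumes [measurable]: "g \<in> borel_measurable M" "A \<in> sets M" and g: "\<And>x. 0 \<le> g x"
    and p: "1 < p" and \<epsilon>: "0 < \<epsilon>" and a: "0 < a" "emeasure M A = ennreal a"
    and N: "(\<integral>\<^sup>+x\<in>A. ennreal (g x powr p) \<partial>M) \<le> ennreal (\<epsilon> powr p)"
  shows "(\<integral>\<^sup>+x\<in>A. ennreal (g x) \<partial>M) \<le> ennreal (2 * \<epsilon> * a powr (1 - 1 / p))"
proof -
  define l where "l = \<epsilon> * a powr (- 1 / p)"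
  have l: "l > 0" using \<epsilon> a by (simp add: l_def)
  have young: "g x \<le> l + l powr (1 - p) * g x powr p" for x
  proof (cases "g x \<le> l")
    case False
    then have "g x powr (1 - p) \<le> l powr (1 - p)"
      using l p by (intro powr_mono2') auto
    then have "g x powr p * g x powr (1 - p) \<le> g x powr p * l powr (1 - p)"
      by (intro mult_left_mono) auto
    moreover have "g x powr p * g x powr (1 - p) = g x"
      using False l by (subst powr_add[symmetric]) auto
    ultimately show ?thesis using l by (simp add: mult.commute)
  qed (auto intro: add_increasing2)
  have "(\<integral>\<^sup>+x\<in>A. ennreal (g x) \<partial>M) \<le>
     (\<integral>\<^sup>+x. ennreal l * indicator A x +
        ennreal (l powr (1 - p)) * (ennreal (g x powr p) * indicator A x) \<partial>M)"
    using young l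
    by (intro nn_integral_mono)
       (auto simp: indicator_def simp flip: ennreal_mult ennreal_plus intro!: ennreal_leI)
  also have "\<dots> = ennreal l * ennreal a +
     ennreal (l powr (1 - p)) * (\<integral>\<^sup>+x\<in>A. ennreal (g x powr p) \<partial>M)"
    by (subst nn_integral_add) (auto simp: nn_integral_cmult a)
  also have "\<dots> \<le> ennreal l * ennreal a + ennreal (l powr (1 - p)) * ennreal (\<epsilon> powr p)"
    by (intro add_left_mono mult_left_mono N) auto
  also have "\<dots> = ennreal (l * a + l powr (1 - p) * \<epsilon> powr p)"
    using l a by (simp add: ennreal_mult)
  also have "l * a + l powr (1 - p) * \<epsilon> powr p = 2 * \<epsilon> * a powr (1 - 1 / p)"
  proof -
    have "l * a = \<epsilon> * (a powr (- 1 / p) * a powr 1)" using a by (simp add: l_def)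
    also have "\<dots> = \<epsilon> * a powr (1 - 1 / p)" by (subst powr_add[symmetric]) simp
    finally have 1: "l * a = \<epsilon> * a powr (1 - 1 / p)" .
    have "l powr (1 - p) = \<epsilon> powr (1 - p) * a powr (1 - 1 / p)"
    proof -
      have "(- 1 / p) * (1 - p) = 1 - 1 / p" using p by (simp add: field_simps)
      then show ?thesis using \<epsilon> a by (simp add: l_def powr_mult powr_powr)
    qed
    then have "l powr (1 - p) * \<epsilon> powr p = (\<epsilon> powr (1 - p) * \<epsilon> powr p) * a powr (1 - 1 / p)"
      by simp
    also have "\<epsilon> powr (1 - p) * \<epsilon> powr p = \<epsilon>"
      using \<epsilon> by (subst powr_add[symmetric]) simp
    finally show ?thesis using 1 by simp
  qed
  finally show ?thesis .
qed

lemma nn_integral_layer_cake: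
  fixes a b :: real
  shows "(\<integral>\<^sup>+t. (if a \<le> t \<and> t < b then c else 0) \<partial>lborel) = c * ennreal (b - a)"
proof -
  have "(\<integral>\<^sup>+t. (if a \<le> t \<and> t < b then c else 0) \<partial>lborel) = (\<integral>\<^sup>+t. c * indicator {a..<b} t \<partial>lborel)"
    by (intro nn_integral_cong) (auto simp: indicator_def)
  also have "\<dots> = c * ennreal (b - a)"
    by (cases "a \<le> b") (auto simp: nn_integral_cmult ennreal_neg)
  finally show ?thesis .
qed

text \<open>On a level set \<open>A = {\<bar>w\<bar> > t}\<close> the integral of \<open>g\<close> is at most \<open>2 \<epsilon> \<bar>A\<bar> powr (1 - s/n)\<close>, hence at most a multiple
  of the fractional perimeter of \<open>A\<close>. Integrating in \<open>t\<close> turns the left-hand sides into \<open>\<integral> g \<bar>w\<bar>\<close> and the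
  perimeters, by the coarea formula, into a part of the seminorm of \<open>w\<close>. Only the restriction of \<open>g\<close> to
  \<open>{w \<noteq> 0}\<close> enters the constant, and this is what makes the inequality useful for high truncations.\<close>

lemma weighted_sobolev:
  fixes s :: real
  assumes s: "0 < s" "s < 1"
  obtains C where "0 < C"
    and "\<And>(w :: 'a::euclidean_space \<Rightarrow> real) g \<epsilon>.
      w \<in> borel_measurable lebesgue \<Longrightarrow> g \<in> borel_measurable lebesgue \<Longrightarrow> (\<And>x. 0 \<le> g x) \<Longrightarrow>
      emeasure lebesgue {x. w x \<noteq> 0} < \<infinity> \<Longrightarrow> 0 < \<epsilon> \<Longrightarrow>
      (\<integral>\<^sup>+x\<in>{x. w x \<noteq> 0}. ennreal (g x powr (DIM('a) / s)) \<partial>lebesgue) \<le> ennreal (\<epsilon> powr (DIM('a) / s)) \<Longrightarrow>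
      (\<integral>\<^sup>+x. ennreal (g x * \<bar>w x\<bar>) \<partial>lebesgue) \<le> ennreal (C * \<epsilon>) * gagliardo s UNIV w"
proof -
  obtain C where C: "0 < C"
    and iso: "\<And>(A :: 'a::euclidean_space set) a x. A \<in> sets lebesgue \<Longrightarrow> 0 < a \<Longrightarrow>
      emeasure lebesgue A = ennreal a \<Longrightarrow>
      ennreal (a powr (- s / DIM('a))) \<le>
        ennreal C * (\<integral>\<^sup>+y. ennreal (gagliardo_kernel s x y) * indicator (- A) y \<partial>lebesgue)"
    using isoperimetric_pointwise[OF s(1)] by blast
  show thesis
  proof (rule that[of "2 * C"])
    show "0 < 2 * C" using C by simp
  next
    fix w g :: "'a \<Rightarrow> real" and \<epsilon> :: real
    assume [measurable]: "w \<in> borel_measurable lebesgue" "g \<in> borel_measurable lebesgue"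
      and g: "\<And>x. 0 \<le> g x" and fin: "emeasure lebesgue {x. w x \<noteq> 0} < \<infinity>" and \<epsilon>: "0 < \<epsilon>"
      and N: "(\<integral>\<^sup>+x\<in>{x. w x \<noteq> 0}. ennreal (g x powr (DIM('a) / s)) \<partial>lebesgue)
        \<le> ennreal (\<epsilon> powr (DIM('a) / s))"
    let ?p = "DIM('a) / s"
    let ?K = "gagliardo_kernel s"
    have "1 \<le> real DIM('a)" using DIM_positive[where 'a='a] by linarith
    then have "s < DIM('a)" using s by linarith
    then have p: "1 < ?p" using s by (simp add: field_simps)
    have level: "(\<integral>\<^sup>+x. (if 0 \<le> t \<and> t < \<bar>w x\<bar> then ennreal (g x) else 0) \<partial>lebesgue) \<le>
        ennreal (2 * C * \<epsilon>) * (\<integral>\<^sup>+x. \<integral>\<^sup>+y.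
          (if \<bar>w y\<bar> \<le> t \<and> t < \<bar>w x\<bar> then ennreal (?K x y) else 0) \<partial>lebesgue \<partial>lebesgue)"
      (is "?L \<le> _ * ?R") for t
    proof (cases "0 \<le> t")
      case t: True
      define A where "A = {x. t < \<bar>w x\<bar>}"
      have Am[measurable]: "A \<in> sets lebesgue"
      proof -
        have "{x \<in> space lebesgue. t < \<bar>w x\<bar>} \<in> sets lebesgue" by measurable
        then show ?thesis by (simp add: A_def)
      qed
      have L: "?L = (\<integral>\<^sup>+x\<in>A. ennreal (g x) \<partial>lebesgue)"
        using t by (intro nn_integral_cong) (auto simp: A_def indicator_def)
      have sub: "A \<subseteq> {x. w x \<noteq> 0}" using t by (auto simp: A_def)
      have wm: "{x. w x \<noteq> 0} \<in> sets lebesgue"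
      proof -
        have "{x \<in> space lebesgue. w x \<noteq> 0} \<in> sets lebesgue" by measurable
        then show ?thesis by simp
      qed
      have "emeasure lebesgue A < \<infinity>" 
        using emeasure_mono[OF sub wm] fin by (rule le_less_trans)
      then obtain a where a: "0 \<le> a" "emeasure lebesgue A = ennreal a"
        by (cases "emeasure lebesgue A") auto
      show ?thesis
      proof (cases "a = 0")
        case True
        then have "A \<in> null_sets lebesgue"
          using a by (intro null_setsI Am) (simp del: emeasure_completion)
        then have "AE x in lebesgue. x \<notin> A" by (rule AE_not_in)
        then have "?L = 0" unfolding L by (subst nn_integral_0_iff_AE) (auto simp: indicator_def)
        then show ?thesis by simp
      next
        case False
        then have a0: "0 < a" using a by simp
        have "(\<integral>\<^sup>+x\<in>A. ennreal (g x powr ?p) \<partial>lebesgue) \<le>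
            (\<integral>\<^sup>+x\<in>{x. w x \<noteq> 0}. ennreal (g x powr ?p) \<partial>lebesgue)"
          using sub by (intro nn_integral_mono) (auto simp: indicator_def)
        from nn_integral_le_powr_measure[OF _ Am g p \<epsilon> a0 a(2) order_trans[OF this N]]
        have "?L \<le> ennreal (2 * \<epsilon> * a powr (1 - 1 / ?p))" by (simp add: L)
        also have "2 * \<epsilon> * a powr (1 - 1 / ?p) = 2 * \<epsilon> * (a powr (- s / DIM('a)) * a powr 1)"
          by (subst powr_add[symmetric]) simp
        also have "ennreal \<dots> = ennreal (2 * \<epsilon>) * (ennreal (a powr (- s / DIM('a))) * emeasure lebesgue A)"
          using \<epsilon> a by (simp add: ennreal_mult)
        also have "ennreal (a powr (- s / DIM('a))) * emeasure lebesgue A =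
            (\<integral>\<^sup>+x\<in>A. ennreal (a powr (- s / DIM('a))) \<partial>lebesgue)"
          by (simp add: nn_integral_cmult_indicator)
        also have "\<dots> \<le> (\<integral>\<^sup>+x. ennreal C * (\<integral>\<^sup>+y.
            (if \<bar>w y\<bar> \<le> t \<and> t < \<bar>w x\<bar> then ennreal (?K x y) else 0) \<partial>lebesgue) \<partial>lebesgue)"
        proof (intro nn_integral_mono)
          fix x
          show "ennreal (a powr (- s / DIM('a))) * indicator A x \<le> ennreal C * (\<integral>\<^sup>+y.
            (if \<bar>w y\<bar> \<le> t \<and> t < \<bar>w x\<bar> then ennreal (?K x y) else 0) \<partial>lebesgue)"
          proof (cases "x \<in> A")
            case True
            have "(\<integral>\<^sup>+y. ennreal (?K x y) * indicator (- A) y \<partial>lebesgue) =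
              (\<integral>\<^sup>+y. (if \<bar>w y\<bar> \<le> t \<and> t < \<bar>w x\<bar> then ennreal (?K x y) else 0) \<partial>lebesgue)"
              using True by (intro nn_integral_cong) (auto simp: A_def indicator_def)
            then show ?thesis using iso[OF Am a0 a(2), of x] True by simp
          qed simp
        qed
        also have "\<dots> = ennreal C * ?R"
          by (rule nn_integral_cmult) measurable
        finally have "?L \<le> ennreal (2 * \<epsilon>) * (ennreal C * ?R)"
          by (simp add: mult_left_mono)
        then show ?thesis
          using C \<epsilon> by (simp add: ennreal_mult mult_ac)
      qed
    qed simp
    have "(\<integral>\<^sup>+x. ennreal (g x * \<bar>w x\<bar>) \<partial>lebesgue) =
       (\<integral>\<^sup>+x. \<integral>\<^sup>+t. (if 0 \<le> t \<and> t < \<bar>w x\<bar> then ennreal (g x) else 0) \<partial>lborel \<partial>lebesgue)"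
      by (simp add: nn_integral_layer_cake ennreal_mult g)
    also have "\<dots> = (\<integral>\<^sup>+t. \<integral>\<^sup>+x. (if 0 \<le> t \<and> t < \<bar>w x\<bar> then ennreal (g x) else 0) \<partial>lebesgue \<partial>lborel)"
      by (rule lborel_lebesgue_pair.Fubini') measurable
    also have "\<dots> \<le> (\<integral>\<^sup>+t. ennreal (2 * C * \<epsilon>) * (\<integral>\<^sup>+x. \<integral>\<^sup>+y.
          (if \<bar>w y\<bar> \<le> t \<and> t < \<bar>w x\<bar> then ennreal (?K x y) else 0) \<partial>lebesgue \<partial>lebesgue) \<partial>lborel)"
      by (intro nn_integral_mono level)
    also have "\<dots> = ennreal (2 * C * \<epsilon>) * (\<integral>\<^sup>+t. \<integral>\<^sup>+x. \<integral>\<^sup>+y.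
          (if \<bar>w y\<bar> \<le> t \<and> t < \<bar>w x\<bar> then ennreal (?K x y) else 0) \<partial>lebesgue \<partial>lebesgue \<partial>lborel)"
      by (rule nn_integral_cmult) measurable
    also have "(\<integral>\<^sup>+t. \<integral>\<^sup>+x. \<integral>\<^sup>+y.
          (if \<bar>w y\<bar> \<le> t \<and> t < \<bar>w x\<bar> then ennreal (?K x y) else 0) \<partial>lebesgue \<partial>lebesgue \<partial>lborel) =
        (\<integral>\<^sup>+x. \<integral>\<^sup>+t. \<integral>\<^sup>+y.
          (if \<bar>w y\<bar> \<le> t \<and> t < \<bar>w x\<bar> then ennreal (?K x y) else 0) \<partial>lebesgue \<partial>lborel \<partial>lebesgue)"
      by (rule lborel_lebesgue_pair.Fubini'[symmetric]) measurable
    also have "\<dots> = (\<integral>\<^sup>+x. \<integral>\<^sup>+y. \<integral>\<^sup>+t.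
          (if \<bar>w y\<bar> \<le> t \<and> t < \<bar>w x\<bar> then ennreal (?K x y) else 0) \<partial>lborel \<partial>lebesgue \<partial>lebesgue)"
      by (intro nn_integral_cong lborel_lebesgue_pair.Fubini'[symmetric]) measurable
    also have "\<dots> = (\<integral>\<^sup>+x. \<integral>\<^sup>+y. ennreal (?K x y) * ennreal (\<bar>w x\<bar> - \<bar>w y\<bar>) \<partial>lebesgue \<partial>lebesgue)"
      by (simp add: nn_integral_layer_cake)
    also have "\<dots> \<le> gagliardo s UNIV w"
      unfolding gagliardo_def gagliardo_kernel_def
      by (intro nn_integral_mono) 
         (auto simp: simp flip: ennreal_mult' intro!: ennreal_leI divide_right_mono nn_integral_mono)
    finally show "(\<integral>\<^sup>+x. ennreal (g x * \<bar>w x\<bar>) \<partial>lebesgue) \<le> ennreal (2 * C * \<epsilon>) * gagliardo s UNIV w"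
      by (simp add: mult_left_mono)
  qed
qed

section \<open>Smooth truncation\<close>

text \<open>A smooth substitute for the part \<open>sgn t * max 0 (\<bar>t\<bar> - k)\<close> of \<open>t\<close> that exceeds height \<open>k\<close>.\<close>

definition excess :: "real \<Rightarrow> real \<Rightarrow> real" where
  "excess k t = flat_exp (t - k) - flat_exp (- t - k)"

lemma excess_mono: "a \<le> b \<Longrightarrow> excess k a \<le> excess k b"
  unfolding excess_def by (intro diff_mono flat_exp_mono) auto

text \<open>The two summands of \<open>excess k\<close> are nonexpansive and, as \<open>k \<ge> 0\<close>, live on disjoint half-lines. When \<open>a\<close> and
  \<open>b\<close> lie on opposite sides, the gap of length \<open>2 k\<close> between the half-lines only helps.\<close>

lemma excess_nonexpansive:
  assumes "0 \<le> k" "a \<le> b" shows "excess k b - excess k a \<le> b - a"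
proof -
  have z: "flat_exp t = 0" if "t \<le> 0" for t using that by (simp add: flat_exp_def)
  have lin: "flat_exp t \<le> t" if "0 \<le> t" for t
    using flat_exp_nonexpansive[OF that] by (simp add: z)
  consider "b \<le> k" | "- k \<le> a" | "k < b" "a < - k" by linarith
  then show ?thesis
  proof cases
    case 1
    then show ?thesis
      using flat_exp_nonexpansive[of "- b - k" "- a - k"] assms z[of "b - k"] z[of "a - k"]
      by (simp add: excess_def)
  next
    case 2
    then show ?thesis
      using flat_exp_nonexpansive[of "a - k" "b - k"] assms z[of "- a - k"] z[of "- b - k"]
      by (simp add: excess_def)
  next
    case 3
    then show ?thesis
      using assms lin[of "b - k"] lin[of "- a - k"] z[of "- b - k"] z[of "a - k"]
      by (simp add: excess_def)
  qed
qed

lemma excess_eq_0_iff: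
  assumes "0 \<le> k" shows "excess k t = 0 \<longleftrightarrow> \<bar>t\<bar> \<le> k"
  using assms by (auto simp: excess_def flat_exp_def)

lemma smooth_real_minus_excess: "smooth_real (\<lambda>t. t - excess k t)"
  using smooth_real_diff[OF smooth_real_ident smooth_real_diff[OF
    smooth_real_affine[OF smooth_real_flat_exp, of 1 "- k"]
    smooth_real_affine[OF smooth_real_flat_exp, of "- 1" "- k"]]]
  by (simp add: excess_def)

text \<open>Both \<open>excess k\<close> and its complement to the identity are nondecreasing, so the two increments have the same sign.\<close>

lemma abs_diff_excess_split:
  assumes "0 \<le> k"
  shows "\<bar>a - b\<bar> = \<bar>(a - excess k a) - (b - excess k b)\<bar> + \<bar>excess k a - excess k b\<bar>"
  using excess_mono[of a b k] excess_mono[of b a k]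
    excess_nonexpansive[OF assms, of a b] excess_nonexpansive[OF assms, of b a]
  by linarith

lemma borel_measurable_excess [measurable]: "excess k \<in> borel_measurable borel"
proof -
  have "mono (excess k)" by (intro monoI excess_mono)
  then show ?thesis by (rule borel_measurable_mono)
qed

lemma gagliardo_excess_split:
  fixes u :: "'a::euclidean_space \<Rightarrow> real"
  assumes [measurable]: "u \<in> borel_measurable lebesgue" and k: "0 \<le> k"
  shows "gagliardo s UNIV u =
    gagliardo s UNIV (\<lambda>x. u x - excess k (u x)) + gagliardo s UNIV (\<lambda>x. excess k (u x))"
proof -
  have U: "UNIV \<in> sets (lebesgue :: 'a measure)" by simp
  let ?M = "lebesgue \<Otimes>\<^sub>M lebesgue :: ('a \<times> 'a) measure"
  have [simp]: "gagliardo s UNIV v = (\<integral>\<^sup>+z. ennreal (\<bar>v (fst z) - v (snd z)\<bar> *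
     gagliardo_kernel s (fst z) (snd z)) \<partial>?M)" if "v \<in> borel_measurable lebesgue" for v :: "'a \<Rightarrow> real"
    using gagliardo_eq_nn_integral_pair[OF that U] by simp
  have "gagliardo s UNIV u = (\<integral>\<^sup>+z.
      ennreal (\<bar>(u (fst z) - excess k (u (fst z))) - (u (snd z) - excess k (u (snd z)))\<bar> *
        gagliardo_kernel s (fst z) (snd z)) +
      ennreal (\<bar>excess k (u (fst z)) - excess k (u (snd z))\<bar> *
        gagliardo_kernel s (fst z) (snd z)) \<partial>?M)"
    by (simp, subst abs_diff_excess_split[OF k]) (simp add: distrib_right)
  also have "\<dots> = gagliardo s UNIV (\<lambda>x. u x - excess k (u x)) + gagliardo s UNIV (\<lambda>x. excess k (u x))"
    by (subst nn_integral_add) simp_all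
  finally show ?thesis .
qed

section \<open>Stability of the space under smooth truncation\<close>

text \<open>Let test functions \<open>\<phi> j\<close> approximate \<open>u\<close> so fast that they also converge almost everywhere. Then \<open>\<Phi> \<circ> \<phi> j\<close> are
  test functions, and only their convergence in the seminorm is in question, since \<open>\<Phi>\<close> being nonexpansive does not
  control \<open>(\<Phi> (u x) - \<Phi> (\<phi> j x)) - (\<Phi> (u y) - \<Phi> (\<phi> j y))\<close> by the same expression without \<open>\<Phi>\<close>. It does so up to
  the error \<open>2 \<bar>u x - u y\<bar>\<close>, which does not depend on \<open>j\<close>. The excess over the controlled part is thus dominated
  by an integrable function and tends to zero almost everywhere, so its integral tends to zero.\<close>

lemma Ws1_zero_compose:
  fixes u :: "'a::euclidean_space \<Rightarrow> real"
  assumes u: "u \<in> Ws1_zero s \<Omega>" and fin: "gagliardo s \<Omega> u < \<infinity>" and \<Omega>: "\<Omega> \<in> sets lebesgue"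
    and \<Phi>: "smooth_real \<Phi>" "\<Phi> 0 = 0" and lip: "\<And>a b. \<bar>\<Phi> a - \<Phi> b\<bar> \<le> \<bar>a - b\<bar>"
  shows "(\<lambda>x. \<Phi> (u x)) \<in> Ws1_zero s \<Omega>"
proof -
  have um[measurable]: "u \<in> borel_measurable lebesgue"
    and u0: "AE x in lebesgue. x \<notin> \<Omega> \<longrightarrow> u x = 0"
    and approx: "\<And>\<epsilon>. 0 < \<epsilon> \<Longrightarrow> \<exists>\<phi>\<in>Cc_infinity \<Omega>. Ws1_norm s \<Omega> (\<lambda>x. u x - \<phi> x) < \<epsilon>"
    using u by (auto simp: Ws1_zero_def)
  note \<Omega>[measurable]
  obtain \<phi> where \<phi>: "\<And>j. \<phi> j \<in> Cc_infinity \<Omega>"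
    and close: "\<And>j. Ws1_norm s \<Omega> (\<lambda>x. u x - \<phi> j x) < ennreal ((1 / 2) ^ j)"
  proof -
    have "\<forall>j::nat. \<exists>\<phi>. \<phi> \<in> Cc_infinity \<Omega> \<and> Ws1_norm s \<Omega> (\<lambda>x. u x - \<phi> x) < ennreal ((1 / 2) ^ j)"
      using approx by (meson ennreal_less_zero_iff half_gt_zero_iff zero_less_one zero_less_power)
    then show ?thesis using that by metis
  qed
  have \<phi>m[measurable]: "\<phi> j \<in> borel_measurable lebesgue" for j
  proof -
    have "C_k 0 (\<phi> j)" using \<phi> unfolding Cc_infinity_def by blast
    then show ?thesis
      by (intro borel_measurable_lebesgueI borel_measurable_continuous_onI) simp
  qed
  have \<Phi>c: "continuous_on UNIV \<Phi>"
    using \<Phi>(1) unfolding smooth_real_def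
    by (metis DERIV_isCont continuous_at_imp_continuous_on)
  then have [measurable]: "\<Phi> \<in> borel_measurable borel"
    by (rule borel_measurable_continuous_onI)
  define P where "P x \<longleftrightarrow> (x \<in> \<Omega> \<longrightarrow> (\<lambda>j. \<phi> j x) \<longlonglongrightarrow> u x)" for x
  have "AE x in lebesgue. P x"
  proof -
    have "(\<integral>\<^sup>+x. (\<Sum>j. ennreal \<bar>u x - \<phi> j x\<bar> * indicator \<Omega> x) \<partial>lebesgue) =
        (\<Sum>j. \<integral>\<^sup>+x\<in>\<Omega>. ennreal \<bar>u x - \<phi> j x\<bar> \<partial>lebesgue)"
      by (rule nn_integral_suminf) measurable
    also have "\<dots> \<le> (\<Sum>j. ennreal ((1 / 2) ^ j))"
    proof (intro suminf_le summableI)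
      fix j
      show "(\<integral>\<^sup>+x\<in>\<Omega>. ennreal \<bar>u x - \<phi> j x\<bar> \<partial>lebesgue) \<le> ennreal ((1 / 2) ^ j)"
        using close[of j] unfolding Ws1_norm_def by (meson le_iff_add less_imp_le order_trans)
    qed
    also have "\<dots> = ennreal (\<Sum>j. (1 / 2) ^ j)"
      by (intro suminf_ennreal2) (auto intro: summable_geometric)
    also have "\<dots> < \<infinity>" by simp
    finally have "(\<integral>\<^sup>+x. (\<Sum>j. ennreal \<bar>u x - \<phi> j x\<bar> * indicator \<Omega> x) \<partial>lebesgue) \<noteq> \<infinity>" by simp
    then have "AE x in lebesgue. (\<Sum>j. ennreal \<bar>u x - \<phi> j x\<bar> * indicator \<Omega> x) \<noteq> \<infinity>"
      by (intro nn_integral_PInf_AE) measurable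
    then show ?thesis
    proof eventually_elim
      case (elim x)
      show ?case unfolding P_def
      proof
        assume "x \<in> \<Omega>"
        then have "summable (\<lambda>j. \<bar>u x - \<phi> j x\<bar>)"
          using elim by (intro summable_suminf_not_top) auto
        then have "(\<lambda>j. u x - \<phi> j x) \<longlonglongrightarrow> 0"
          using summable_LIMSEQ_zero tendsto_rabs_zero_iff by blast
        then have "(\<lambda>j. u x - (u x - \<phi> j x)) \<longlonglongrightarrow> u x - 0"
          by (intro tendsto_diff tendsto_const)
        then show "(\<lambda>j. \<phi> j x) \<longlonglongrightarrow> u x" by simp
      qed
    qed
  qed
  then obtain N where N: "N \<in> null_sets lebesgue" "\<And>x. x \<notin> N \<Longrightarrow> P x"
    using AE_E3 by (metis Diff_iff UNIV_I space_completion space_lborel space_borel)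
  note [measurable] = null_setsD2[OF N(1)]
  let ?M = "lebesgue \<Otimes>\<^sub>M lebesgue :: ('a \<times> 'a) measure"
  let ?K = "\<lambda>z. gagliardo_kernel s (fst z) (snd z)"
  have AE_fst: "AE z in ?M. fst z \<notin> N"
    by (rule lebesgue_pair.AE_pair_measure) (use AE_not_in[OF N(1)] in auto)
  have AE_snd: "AE z in ?M. snd z \<notin> N"
    by (rule lebesgue_pair.AE_pair_measure) (use AE_not_in[OF N(1)] in auto)
  \<comment> \<open>\<open>D\<close> and \<open>H\<close> are the seminorm integrands of \<open>u -
    \<phi> j\<close> and \<open>\<Phi> \<circ> u - \<Phi> \<circ> \<phi> j\<close>, and
    \<open>r\<close> integrates the excess of \<open>H\<close> over \<open>D\<close>.\<close>
  define D where "D j z = \<bar>(u (fst z) - \<phi> j (fst z)) - (u (snd z) - \<phi> j (snd z))\<bar> * ?K z" for j z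
  define H where "H j z = \<bar>(\<Phi> (u (fst z)) - \<Phi> (\<phi> j (fst z))) -
      (\<Phi> (u (snd z)) - \<Phi> (\<phi> j (snd z)))\<bar> * ?K z" for j z
  define U where "U z = \<bar>u (fst z) - u (snd z)\<bar> * ?K z" for z
  define r where "r j = (\<integral>\<^sup>+z. ennreal (max 0 (H j z - D j z)) * indicator (\<Omega> \<times> \<Omega>) z \<partial>?M)" for j
  have [measurable]: "D j \<in> borel_measurable ?M" "H j \<in> borel_measurable ?M"
      "U \<in> borel_measurable ?M" for j
    unfolding D_def H_def U_def by measurable
  have HDU: "H j z \<le> D j z + 2 * U z" for j z
  proof -
    have "\<bar>(\<Phi> (u (fst z)) - \<Phi> (\<phi> j (fst z))) - (\<Phi> (u (snd z)) - \<Phi> (\<phi> j (snd z)))\<bar> \<le>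
       \<bar>(u (fst z) - \<phi> j (fst z)) - (u (snd z) - \<phi> j (snd z))\<bar> + 2 * \<bar>u (fst z) - u (snd z)\<bar>"
    proof -
      have "\<bar>(\<Phi> a - \<Phi> a') - (\<Phi> b - \<Phi> b')\<bar> \<le> \<bar>(a - a') - (b - b')\<bar> + 2 * \<bar>a - b\<bar>" for a a' b b'
      proof -
        have "\<bar>(\<Phi> a - \<Phi> a') - (\<Phi> b - \<Phi> b')\<bar> \<le> \<bar>\<Phi> a - \<Phi> b\<bar> + \<bar>\<Phi> a' - \<Phi> b'\<bar>" by linarith
        also have "\<dots> \<le> \<bar>a - b\<bar> + \<bar>a' - b'\<bar>" by (intro add_mono lip)
        also have "\<dots> \<le> \<bar>(a - a') - (b - b')\<bar> + 2 * \<bar>a - b\<bar>"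
          using abs_triangle_ineq4[of "a - b" "(a - a') - (b - b')"] by simp
        finally show ?thesis .
      qed
      then show ?thesis .
    qed
    from mult_right_mono[OF this gagliardo_kernel_nonneg] show ?thesis
      by (simp add: H_def D_def U_def distrib_right mult.assoc)
  qed
  have nonneg: "0 \<le> D j z" "0 \<le> H j z" "0 \<le> U z" for j z
    by (auto simp: D_def H_def U_def)
  have "r \<longlonglongrightarrow> (\<integral>\<^sup>+z. 0 \<partial>?M)"
    unfolding r_def
  proof (rule nn_integral_dominated_convergence)
    show "AE z in ?M. ennreal (max 0 (H j z - D j z)) * indicator (\<Omega> \<times> \<Omega>) z \<le>
        2 * (ennreal (U z) * indicator (\<Omega> \<times> \<Omega>) z)" for j
    proof (intro AE_I2)
      fix z
      have "ennreal (max 0 (H j z - D j z)) \<le> ennreal (2 * U z)"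
        using HDU[of j z] nonneg(3)[of z] by (intro ennreal_leI) auto
      then show "ennreal (max 0 (H j z - D j z)) * indicator (\<Omega> \<times> \<Omega>) z \<le>
          2 * (ennreal (U z) * indicator (\<Omega> \<times> \<Omega>) z)"
        using nonneg(3)[of z] by (auto simp: indicator_def ennreal_mult)
    qed
    have "(\<integral>\<^sup>+z. 2 * (ennreal (U z) * indicator (\<Omega> \<times> \<Omega>) z) \<partial>?M) = 2 * gagliardo s \<Omega> u"
      by (subst nn_integral_cmult) (simp_all add: gagliardo_eq_nn_integral_pair U_def)
    then show "(\<integral>\<^sup>+z. 2 * (ennreal (U z) * indicator (\<Omega> \<times> \<Omega>) z) \<partial>?M) < \<infinity>"
      using fin by (simp add: ennreal_mult_less_top)
    show "AE z in ?M. (\<lambda>j. ennreal (max 0 (H j z - D j z)) * indicator (\<Omega> \<times> \<Omega>) z) \<longlonglongrightarrow> 0"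
      using AE_fst AE_snd
    proof eventually_elim
      case (elim z)
      show ?case
      proof (cases "z \<in> \<Omega> \<times> \<Omega>")
        case True
        have "(\<lambda>j. \<phi> j (fst z)) \<longlonglongrightarrow> u (fst z)" "(\<lambda>j. \<phi> j (snd z)) \<longlonglongrightarrow> u (snd z)"
          using N(2)[of "fst z"] N(2)[of "snd z"] elim True by (auto simp: P_def)
        then have "(\<lambda>j. \<Phi> (\<phi> j (fst z))) \<longlonglongrightarrow> \<Phi> (u (fst z))"
            "(\<lambda>j. \<Phi> (\<phi> j (snd z))) \<longlonglongrightarrow> \<Phi> (u (snd z))"
          using \<Phi>c by (auto intro: continuous_on_tendsto_compose)
        then have "(\<lambda>j. H j z) \<longlonglongrightarrow> \<bar>(\<Phi> (u (fst z)) - \<Phi> (u (fst z))) - (\<Phi> (u (snd z)) - \<Phi> (u (snd z)))\<bar> * ?K z"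
          unfolding H_def by (intro tendsto_intros)
        then have "(\<lambda>j. H j z) \<longlonglongrightarrow> 0" by simp
        then have "(\<lambda>j. max 0 (H j z - D j z)) \<longlonglongrightarrow> 0"
          by (rule tendsto_sandwich[OF _ _ tendsto_const, rotated 2])
             (use nonneg in auto)
        then have "(\<lambda>j. ennreal (max 0 (H j z - D j z))) \<longlonglongrightarrow> ennreal 0"
          by (rule tendsto_ennrealI)
        then show ?thesis using True by simp
      qed simp
    qed
  qed measurable
  then have r0: "r \<longlonglongrightarrow> 0" by simp
  have bound: "Ws1_norm s \<Omega> (\<lambda>x. \<Phi> (u x) - \<Phi> (\<phi> j x)) \<le> ennreal ((1 / 2) ^ j) + r j" for j
  proof -
    have "gagliardo s \<Omega> (\<lambda>x. \<Phi> (u x) - \<Phi> (\<phi> j x)) =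
        (\<integral>\<^sup>+z. ennreal (H j z) * indicator (\<Omega> \<times> \<Omega>) z \<partial>?M)"
      by (subst gagliardo_eq_nn_integral_pair) (simp_all add: H_def)
    also have "\<dots> \<le> (\<integral>\<^sup>+z. ennreal (D j z) * indicator (\<Omega> \<times> \<Omega>) z +
        ennreal (max 0 (H j z - D j z)) * indicator (\<Omega> \<times> \<Omega>) z \<partial>?M)"
      using nonneg
      by (intro nn_integral_mono) (auto simp: indicator_def simp flip: ennreal_plus intro!: ennreal_leI)
    also have "\<dots> = (\<integral>\<^sup>+z. ennreal (D j z) * indicator (\<Omega> \<times> \<Omega>) z \<partial>?M) + r j"
      unfolding r_def by (rule nn_integral_add) measurable
    also have "(\<integral>\<^sup>+z. ennreal (D j z) * indicator (\<Omega> \<times> \<Omega>) z \<partial>?M) = gagliardo s \<Omega> (\<lambda>x. u x - \<phi> j x)"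
      by (subst gagliardo_eq_nn_integral_pair) (simp_all add: D_def)
    finally have "gagliardo s \<Omega> (\<lambda>x. \<Phi> (u x) - \<Phi> (\<phi> j x)) \<le> gagliardo s \<Omega> (\<lambda>x. u x - \<phi> j x) + r j" .
    moreover have "(\<integral>\<^sup>+x\<in>\<Omega>. ennreal \<bar>\<Phi> (u x) - \<Phi> (\<phi> j x)\<bar> \<partial>lebesgue) \<le>
        (\<integral>\<^sup>+x\<in>\<Omega>. ennreal \<bar>u x - \<phi> j x\<bar> \<partial>lebesgue)"
      by (intro nn_integral_mono mult_right_mono ennreal_leI lip) auto
    ultimately have "Ws1_norm s \<Omega> (\<lambda>x. \<Phi> (u x) - \<Phi> (\<phi> j x)) \<le> Ws1_norm s \<Omega> (\<lambda>x. u x - \<phi> j x) + r j"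
      unfolding Ws1_norm_def by (simp add: add.assoc add_mono)
    also have "\<dots> \<le> ennreal ((1 / 2) ^ j) + r j"
      using close[of j] by (intro add_right_mono) simp
    finally show ?thesis .
  qed
  have "(\<lambda>j. ennreal ((1 / 2) ^ j) + r j) \<longlonglongrightarrow> ennreal 0 + 0"
    by (intro tendsto_add r0 tendsto_ennrealI LIMSEQ_power_zero) auto
  then have lim: "(\<lambda>j. ennreal ((1 / 2) ^ j) + r j) \<longlonglongrightarrow> 0" by simp
  have "\<exists>\<psi>\<in>Cc_infinity \<Omega>. Ws1_norm s \<Omega> (\<lambda>x. \<Phi> (u x) - \<psi> x) < \<epsilon>" if "0 < \<epsilon>" for \<epsilon>
  proof -
    have "eventually (\<lambda>j. ennreal ((1 / 2) ^ j) + r j < \<epsilon>) sequentially"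
      using lim that by (rule order_tendstoD(2))
    then obtain j where "ennreal ((1 / 2) ^ j) + r j < \<epsilon>"
      using eventually_happens' sequentially_bot by blast
    with bound[of j] have "Ws1_norm s \<Omega> (\<lambda>x. \<Phi> (u x) - \<Phi> (\<phi> j x)) < \<epsilon>" by (rule le_less_trans)
    moreover have "(\<lambda>x. \<Phi> (\<phi> j x)) \<in> Cc_infinity \<Omega>"
      by (rule Cc_infinity_compose[OF \<Phi> \<phi>])
    ultimately show ?thesis by (rule bexI)
  qed
  moreover have "AE x in lebesgue. x \<notin> \<Omega> \<longrightarrow> \<Phi> (u x) = 0"
    using u0 by eventually_elim (simp add: \<Phi>(2))
  ultimately show ?thesis by (simp add: Ws1_zero_def)
qed

lemma zero_in_Ws1_zero: "(\<lambda>_. 0) \<in> Ws1_zero s \<Omega>"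
proof -
  have "C_k k (\<lambda>_::'a. 0 :: real)" for k
    by (induction k) auto
  then have "(\<lambda>_. 0) \<in> Cc_infinity \<Omega>" by (simp add: Cc_infinity_def)
  moreover have "Ws1_norm s \<Omega> (\<lambda>_. 0 - 0) = 0" by (simp add: Ws1_norm_def gagliardo_def)
  ultimately show ?thesis
    unfolding Ws1_zero_def by (auto intro!: bexI[of _ "\<lambda>_. 0"])
qed

section \<open>Minimizers\<close>

text \<open>Testing minimality against \<open>u - w\<close> with \<open>w = excess k \<circ> u\<close> gives \<open>[w] / 2 \<le> \<integral> f w\<close>, while \<open>weighted_sobolev\<close> gives
  \<open>\<integral> \<bar>f w\<bar> \<le> [w] / 4\<close> once the integral of \<open>\<bar>f\<bar> powr p\<close> over \<open>{\<bar>u\<bar> > k}\<close> is small. Then \<open>[w] = 0\<close>, and the Sobolev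
  inequality with weight \<open>1\<close> on \<open>\<Omega>\<close> shows \<open>w = 0\<close>. The threshold \<open>\<delta>\<close> does not depend on \<open>k\<close>. The last two
  conclusions concern the extension \<open>g\<close> of \<open>\<bar>f\<bar>\<close> by zero and serve to make that integral small later.\<close>

lemma minimizer_excess_vanishes:
  fixes \<Omega> :: "'a::euclidean_space set" and s :: real and f u :: "'a \<Rightarrow> real"
  defines "g \<equiv> \<lambda>x. if x \<in> \<Omega> then \<bar>f x\<bar> else 0"
  assumes s: "0 < s" "s < 1"
    and \<Omega>: "open \<Omega>" "bounded \<Omega>"
    and f: "f \<in> Lp_on (DIM('a) / s) \<Omega>"
    and u: "F1_minimizer s \<Omega> f u"
  obtains \<delta> where "0 < \<delta>"
    and "\<And>k. 0 \<le> k \<Longrightarrow>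
      (\<integral>\<^sup>+x\<in>{x. k < \<bar>u x\<bar>}. ennreal (g x powr (DIM('a) / s)) \<partial>lebesgue) \<le> ennreal \<delta> \<Longrightarrow>
      AE x in lebesgue. \<bar>u x\<bar> \<le> k"
    and "g \<in> borel_measurable lebesgue"
    and "(\<integral>\<^sup>+x. ennreal (g x powr (DIM('a) / s)) \<partial>lebesgue) < \<infinity>"
proof -
  let ?p = "DIM('a) / s"
  have p: "0 < ?p" using s by simp
  have \<Omega>m[measurable]: "\<Omega> \<in> sets lebesgue" using \<Omega>(1) by (intro sets_completionI_sets) simp
  have uW: "u \<in> Ws1_zero s \<Omega>" and min: "\<And>v. v \<in> Ws1_zero s \<Omega> \<Longrightarrow> F1 s \<Omega> f u \<le> F1 s \<Omega> f v"
    using u by (auto simp: F1_minimizer_def)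
  have um[measurable]: "u \<in> borel_measurable lebesgue"
    and u0: "AE x in lebesgue. x \<notin> \<Omega> \<longrightarrow> u x = 0"
    using uW by (auto simp: Ws1_zero_def)
  have f\<Omega>m[measurable]: "(\<lambda>x. if x \<in> \<Omega> then f x else 0) \<in> borel_measurable lebesgue"
    using f \<Omega>m by (simp add: Lp_on_def borel_measurable_if)
  have g_eq: "g = (\<lambda>x. \<bar>if x \<in> \<Omega> then f x else 0\<bar>)" by (auto simp: g_def)
  have gm[measurable]: "g \<in> borel_measurable lebesgue" unfolding g_eq by measurable
  have g0: "0 \<le> g x" for x by (simp add: g_def)
  have gN: "(\<integral>\<^sup>+x. ennreal (g x powr ?p) \<partial>lebesgue) < \<infinity>"
  proof -
    have "(\<integral>\<^sup>+x. ennreal (g x powr ?p) \<partial>lebesgue) = (\<integral>\<^sup>+x\<in>\<Omega>. ennreal (\<bar>f x\<bar> powr ?p) \<partial>lebesgue)"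
      by (intro nn_integral_cong) (auto simp: g_def indicator_def)
    also have "\<dots> = (\<integral>\<^sup>+x. ennreal (\<bar>f x\<bar> powr ?p) \<partial>lebesgue_on \<Omega>)"
      using \<Omega>m by (subst nn_integral_restrict_space) auto
    also have "\<dots> < \<infinity>"
      using f by (auto simp: Lp_on_def integrable_iff_bounded)
    finally show ?thesis .
  qed
  \<comment> \<open>One crude scale that bounds both the weight \<open>g\<close> and the weight
    \<open>1\<close> on \<open>\<Omega>\<close>.\<close>
  obtain \<epsilon>0 where \<epsilon>0: "0 < \<epsilon>0" "(\<integral>\<^sup>+x. ennreal (g x powr ?p) \<partial>lebesgue) \<le> ennreal (\<epsilon>0 powr ?p)"
      "emeasure lebesgue \<Omega> \<le> ennreal (\<epsilon>0 powr ?p)"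
  proof -
    have "emeasure lebesgue \<Omega> < \<infinity>"
      using emeasure_bounded_finite[OF \<Omega>(2)] \<Omega>(1) by simp
    then obtain b where b: "0 \<le> b" "emeasure lebesgue \<Omega> = ennreal b"
      by (cases "emeasure lebesgue \<Omega>") auto
    obtain a where a: "0 \<le> a" "(\<integral>\<^sup>+x. ennreal (g x powr ?p) \<partial>lebesgue) = ennreal a"
      using gN by (cases "\<integral>\<^sup>+x. ennreal (g x powr ?p) \<partial>lebesgue") auto
    define \<epsilon> where "\<epsilon> = (1 + a + b) powr (1 / ?p)"
    have "\<epsilon> powr ?p = 1 + a + b" using s a b by (simp add: \<epsilon>_def powr_powr)
    moreover have "0 < \<epsilon>" using a b by (simp add: \<epsilon>_def)
    ultimately show thesis
      using a b by (intro that[of \<epsilon>]) (auto intro!: ennreal_leI)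
  qed
  obtain C where C: "0 < C"
    and sob: "\<And>(w :: 'a \<Rightarrow> real) g \<epsilon>.
      w \<in> borel_measurable lebesgue \<Longrightarrow> g \<in> borel_measurable lebesgue \<Longrightarrow> (\<And>x. 0 \<le> g x) \<Longrightarrow>
      emeasure lebesgue {x. w x \<noteq> 0} < \<infinity> \<Longrightarrow> 0 < \<epsilon> \<Longrightarrow>
      (\<integral>\<^sup>+x\<in>{x. w x \<noteq> 0}. ennreal (g x powr ?p) \<partial>lebesgue) \<le> ennreal (\<epsilon> powr ?p) \<Longrightarrow>
      (\<integral>\<^sup>+x. ennreal (g x * \<bar>w x\<bar>) \<partial>lebesgue) \<le> ennreal (C * \<epsilon>) * gagliardo s UNIV w"
    using weighted_sobolev[OF s, where 'a='a] by blast
  have supp: "emeasure lebesgue {x. w x \<noteq> 0} \<le> emeasure lebesgue \<Omega>"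
    if "AE x in lebesgue. x \<notin> \<Omega> \<longrightarrow> w x = 0" for w :: "'a \<Rightarrow> real"
    using that by (intro emeasure_mono_AE) (auto elim: eventually_mono)
  have supp_fin: "emeasure lebesgue {x. w x \<noteq> 0} < \<infinity>"
    if "AE x in lebesgue. x \<notin> \<Omega> \<longrightarrow> w x = 0" for w :: "'a \<Rightarrow> real"
    using order_trans[OF supp[OF that] \<epsilon>0(3)] by (rule le_less_trans) simp
  have int: "integrable lebesgue (\<lambda>x. indicator \<Omega> x *\<^sub>R (f x * w x))"
    if [measurable]: "w \<in> borel_measurable lebesgue" and w0: "AE x in lebesgue. x \<notin> \<Omega> \<longrightarrow> w x = 0"
      and fin: "gagliardo s UNIV w < \<infinity>" for w
  proof -
    have eq: "(\<lambda>x. indicator \<Omega> x *\<^sub>R (f x * w x)) = (\<lambda>x. (if x \<in> \<Omega> then f x else 0) * w x)"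
      by (auto simp: indicator_def)
    have "(\<integral>\<^sup>+x\<in>{x. w x \<noteq> 0}. ennreal (g x powr ?p) \<partial>lebesgue) \<le> (\<integral>\<^sup>+x. ennreal (g x powr ?p) \<partial>lebesgue)"
      by (intro nn_integral_mono) (auto simp: indicator_def)
    from sob[OF _ _ g0 supp_fin[OF w0] \<epsilon>0(1) order_trans[OF this \<epsilon>0(2)]]
    have "(\<integral>\<^sup>+x. ennreal (g x * \<bar>w x\<bar>) \<partial>lebesgue) \<le> ennreal (C * \<epsilon>0) * gagliardo s UNIV w" by simp
    also have "\<dots> < \<infinity>" using fin by (simp add: ennreal_mult_less_top)
    finally have "(\<integral>\<^sup>+x. ennreal (g x * \<bar>w x\<bar>) \<partial>lebesgue) < \<infinity>" .
    then show ?thesis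
      unfolding eq by (intro integrableI_bounded) (auto simp: g_eq abs_mult)
  qed
  \<comment> \<open>Membership in the space controls the seminorm only over \<open>\<Omega>\<close>;
    over the whole space it is finite because \<open>u\<close> does at least as well as the zero
    function.\<close>
  have u_fin: "gagliardo s UNIV u < \<infinity>"
  proof (rule ccontr)
    assume "\<not> gagliardo s UNIV u < \<infinity>"
    then have "F1 s \<Omega> f u = \<infinity>" by (simp add: F1_def less_top[symmetric])
    moreover have "F1 s \<Omega> f (\<lambda>_. 0) = 0" by (simp add: F1_def gagliardo_def zero_ennreal.rep_eq)
    ultimately show False using min[OF zero_in_Ws1_zero] by simp
  qed
  \<comment> \<open>Any Sobolev factor \<open>C * \<epsilon>\<close> below \<open>1/2\<close> lets
    the right-hand side be absorbed.\<close>
  define \<epsilon> where "\<epsilon> = 1 / (4 * C)"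
  have \<epsilon>: "0 < \<epsilon>" "C * \<epsilon> = 1 / 4" using C by (auto simp: \<epsilon>_def)
  show thesis
  proof (rule that[of "\<epsilon> powr ?p"])
    show "0 < \<epsilon> powr ?p" using \<epsilon> by simp
    show "g \<in> borel_measurable lebesgue" by (rule gm)
    show "(\<integral>\<^sup>+x. ennreal (g x powr ?p) \<partial>lebesgue) < \<infinity>" by (rule gN)
  next
    fix k :: real
    assume k: "0 \<le> k"
      and small: "(\<integral>\<^sup>+x\<in>{x. k < \<bar>u x\<bar>}. ennreal (g x powr ?p) \<partial>lebesgue) \<le> ennreal (\<epsilon> powr ?p)"
    define w where "w x = excess k (u x)" for x
    define v where "v x = u x - w x" for x
    have [measurable]: "w \<in> borel_measurable lebesgue" "v \<in> borel_measurable lebesgue"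
      unfolding w_def v_def by measurable
    have w_iff: "w x \<noteq> 0 \<longleftrightarrow> k < \<bar>u x\<bar>" for x
      using excess_eq_0_iff[OF k] by (auto simp: w_def not_le)
    have w0: "AE x in lebesgue. x \<notin> \<Omega> \<longrightarrow> w x = 0"
      using u0 by eventually_elim (use w_iff k in force)
    have v0: "AE x in lebesgue. x \<notin> \<Omega> \<longrightarrow> v x = 0"
      using u0 w0 by eventually_elim (simp add: v_def)
    have "gagliardo s \<Omega> u \<le> gagliardo s UNIV u"
      unfolding gagliardo_def
      by (auto intro!: nn_integral_mono simp: indicator_def)
    then have u_fin': "gagliardo s \<Omega> u < \<infinity>" using u_fin by (rule le_less_trans)
    have vW: "v \<in> Ws1_zero s \<Omega>"
    proof -
      have "\<bar>(a - excess k a) - (b - excess k b)\<bar> \<le> \<bar>a - b\<bar>" for a b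
        using abs_diff_excess_split[OF k, of a b] by simp
      then show ?thesis
        unfolding v_def w_def
        using Ws1_zero_compose[OF uW u_fin' \<Omega>m smooth_real_minus_excess[of k]] excess_eq_0_iff[OF k, of 0] k
        by simp
    qed
    have split: "gagliardo s UNIV u = gagliardo s UNIV v + gagliardo s UNIV w"
      unfolding v_def w_def by (rule gagliardo_excess_split[OF um k])
    have v_fin: "gagliardo s UNIV v < \<infinity>" and w_fin: "gagliardo s UNIV w < \<infinity>"
      using u_fin unfolding split by auto
    obtain V where V: "0 \<le> V" "gagliardo s UNIV v = ennreal V"
      using v_fin by (cases "gagliardo s UNIV v") auto
    obtain W where W: "0 \<le> W" "gagliardo s UNIV w = ennreal W"
      using w_fin by (cases "gagliardo s UNIV w") auto
    have U: "gagliardo s UNIV u = ennreal (V + W)" using V W split by simp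
    define I where "I h = (LINT x:\<Omega>|lebesgue. f x * h x)" for h
    have "I u = I v + I w"
    proof -
      have "I u = (LINT x|lebesgue. indicator \<Omega> x *\<^sub>R (f x * v x) + indicator \<Omega> x *\<^sub>R (f x * w x))"
        unfolding I_def set_lebesgue_integral_def
        by (intro Bochner_Integration.integral_cong) (auto simp: v_def algebra_simps)
      also have "\<dots> = I v + I w"
        unfolding I_def set_lebesgue_integral_def
        by (intro Bochner_Integration.integral_add int v0 w0 v_fin w_fin) measurable
      finally show ?thesis .
    qed
    moreover have "(V + W) / 2 - I u \<le> V / 2 - I v"
      using min[OF vW] V W by (simp add: F1_def I_def U enn2ereal_ennreal del: ennreal_plus)
    ultimately have "W / 2 \<le> I w" by (simp add: add_divide_distrib)
    also have "ennreal (I w) \<le> ennreal (W / 4)"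
    proof -
      have "ennreal (I w) \<le> ennreal (norm (I w))" by (intro ennreal_leI) simp
      also have "\<dots> \<le> (\<integral>\<^sup>+x. norm (indicator \<Omega> x *\<^sub>R (f x * w x)) \<partial>lebesgue)"
        unfolding I_def set_lebesgue_integral_def
        by (intro integral_norm_bound_ennreal int w0 w_fin) measurable
      also have "\<dots> = (\<integral>\<^sup>+x. ennreal (g x * \<bar>w x\<bar>) \<partial>lebesgue)"
        by (intro nn_integral_cong) (auto simp: g_def indicator_def abs_mult)
      also have "\<dots> \<le> ennreal (C * \<epsilon>) * gagliardo s UNIV w"
        using small by (intro sob g0 supp_fin[OF w0] \<epsilon>(1)) (simp_all add: w_iff)
      also have "\<dots> = ennreal (W / 4)" using W(1) by (simp add: W(2) \<epsilon>(2) flip: ennreal_mult)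
      finally show ?thesis .
    qed
    then have "I w \<le> W / 4" using W(1) by (simp add: ennreal_le_iff)
    finally have "W = 0" using W(1) by simp
    have "(\<integral>\<^sup>+x\<in>{x. w x \<noteq> 0}. ennreal (indicator \<Omega> x powr ?p) \<partial>lebesgue) \<le> (\<integral>\<^sup>+x. indicator \<Omega> x \<partial>lebesgue)"
      by (intro nn_integral_mono) (auto simp: indicator_def)
    also have "\<dots> \<le> ennreal (\<epsilon>0 powr ?p)" using \<epsilon>0(3) by simp
    finally have "(\<integral>\<^sup>+x. ennreal (indicator \<Omega> x * \<bar>w x\<bar>) \<partial>lebesgue) \<le> ennreal (C * \<epsilon>0) * gagliardo s UNIV w"
      by (intro sob supp_fin[OF w0] \<epsilon>0(1)) auto
    then have "(\<integral>\<^sup>+x. ennreal (indicator \<Omega> x * \<bar>w x\<bar>) \<partial>lebesgue) = 0"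
      by (simp add: W(2) \<open>W = 0\<close>)
    then have "AE x in lebesgue. ennreal (indicator \<Omega> x * \<bar>w x\<bar>) = 0"
      by (subst (asm) nn_integral_0_iff_AE) auto
    then show "AE x in lebesgue. \<bar>u x\<bar> \<le> k"
      using w0
    proof eventually_elim
      case (elim x)
      then have "w x = 0" by (cases "x \<in> \<Omega>") (auto simp: ennreal_eq_0_iff)
      then show ?case using w_iff[of x] by simp
    qed
  qed
qed

theorem theorem6p2:
  fixes \<Omega> :: "'a::euclidean_space set" and s :: real and f u :: "'a \<Rightarrow> real"
  assumes "0 < s" and "s < 1"
    and "open \<Omega>" and "bounded \<Omega>" and "lipschitz_boundary \<Omega>"
    and "f \<in> Lp_on (real DIM('a) / s) \<Omega>"
    and "F1_minimizer s \<Omega> f u"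
  shows "u \<in> Linf \<and> emeasure lebesgue {x. ereal \<bar>u x\<bar> = Linf_norm u} > 0"
proof -
  have um[measurable]: "u \<in> borel_measurable lebesgue"
    using assms(7) by (auto simp: F1_minimizer_def Ws1_zero_def)
  define g where "g x = (if x \<in> \<Omega> then \<bar>f x\<bar> else 0)" for x
  let ?p = "DIM('a) / s"
  obtain \<delta> where \<delta>: "0 < \<delta>"
    and van: "\<And>k. 0 \<le> k \<Longrightarrow>
      (\<integral>\<^sup>+x\<in>{x. k < \<bar>u x\<bar>}. ennreal (g x powr ?p) \<partial>lebesgue) \<le> ennreal \<delta> \<Longrightarrow>
      AE x in lebesgue. \<bar>u x\<bar> \<le> k"
    and gm[measurable]: "g \<in> borel_measurable lebesgue"
    and gN: "(\<integral>\<^sup>+x. ennreal (g x powr ?p) \<partial>lebesgue) < \<infinity>"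
    using minimizer_excess_vanishes[OF assms(1-4,6,7)] unfolding g_def by blast
  \<comment> \<open>Heights that eventually dominate \<open>\<bar>u\<bar>\<close> at almost every
    point contain one that dominates it almost everywhere, because the integral of \<open>g powr
    p\<close> over \<open>{\<bar>u\<bar> > k j}\<close> tends to zero.\<close>
  have descent: "\<exists>j. AE x in lebesgue. \<bar>u x\<bar> \<le> k j"
    if k: "\<And>j. 0 \<le> k j" and ev: "AE x in lebesgue. eventually (\<lambda>j. \<bar>u x\<bar> \<le> k j) sequentially"
    for k :: "nat \<Rightarrow> real"
  proof -
    have Em: "{x. k j < \<bar>u x\<bar>} \<in> sets lebesgue" for j
    proof -
      have "{x \<in> space lebesgue. k j < \<bar>u x\<bar>} \<in> sets lebesgue" by measurable
      then show ?thesis by simp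
    qed
    have "(\<lambda>j. \<integral>\<^sup>+x\<in>{x. k j < \<bar>u x\<bar>}. ennreal (g x powr ?p) \<partial>lebesgue) \<longlonglongrightarrow> (\<integral>\<^sup>+x. 0 \<partial>(lebesgue :: 'a measure))"
    proof (rule nn_integral_dominated_convergence)
      show "AE x in lebesgue. (\<lambda>j. ennreal (g x powr ?p) * indicator {x. k j < \<bar>u x\<bar>} x) \<longlonglongrightarrow> 0"
        using ev
      proof eventually_elim
        case (elim x)
        then have "eventually (\<lambda>j. ennreal (g x powr ?p) * indicator {x. k j < \<bar>u x\<bar>} x = 0) sequentially"
          by eventually_elim simp
        then show ?case by (rule tendsto_eventually)
      qed
      show "AE x in lebesgue. ennreal (g x powr ?p) * indicator {x. k j < \<bar>u x\<bar>} x \<le> ennreal (g x powr ?p)" for j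
        by (auto simp: indicator_def)
    qed (use Em gN in measurable)
    then have "(\<lambda>j. \<integral>\<^sup>+x\<in>{x. k j < \<bar>u x\<bar>}. ennreal (g x powr ?p) \<partial>lebesgue) \<longlonglongrightarrow> 0" by simp
    then have "eventually (\<lambda>j. (\<integral>\<^sup>+x\<in>{x. k j < \<bar>u x\<bar>}. ennreal (g x powr ?p) \<partial>lebesgue) < ennreal \<delta>) sequentially"
      using \<delta> by (intro order_tendstoD(2)) auto
    then obtain j where "(\<integral>\<^sup>+x\<in>{x. k j < \<bar>u x\<bar>}. ennreal (g x powr ?p) \<partial>lebesgue) < ennreal \<delta>"
      using eventually_happens' sequentially_bot by blast
    then show ?thesis using van[OF k] less_imp_le by blast
  qed
  have norm_le: "Linf_norm u \<le> ereal c" if "AE x in lebesgue. \<bar>u x\<bar> \<le> c" for c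
    unfolding Linf_norm_def using that by (intro esssup_I) auto
  have AE_norm: "AE x in lebesgue. ereal \<bar>u x\<bar> \<le> Linf_norm u"
    unfolding Linf_norm_def by (rule esssup_AE)
  obtain j where "AE x in lebesgue. \<bar>u x\<bar> \<le> real j"
  proof -
    have "AE x in lebesgue. eventually (\<lambda>j. \<bar>u x\<bar> \<le> real j) sequentially"
    proof (intro AE_I2)
      fix x
      obtain n where "\<bar>u x\<bar> \<le> real n" using real_arch_simple by blast
      then show "eventually (\<lambda>j. \<bar>u x\<bar> \<le> real j) sequentially"
        by (intro eventually_sequentiallyI[of n]) (meson of_nat_mono order_trans)
    qed
    then show ?thesis using that descent[of real] by auto
  qed
  then have lt: "Linf_norm u < \<infinity>" using norm_le[of "real j"] le_less_trans by fastforce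
  have not_AE_False: "\<not> (AE x in (lebesgue :: 'a measure). False)"
    by (simp add: eventually_False ae_filter_eq_bot_iff emeasure_lborel_UNIV)
  have ge: "0 \<le> Linf_norm u"
  proof (rule ccontr)
    assume neg: "\<not> 0 \<le> Linf_norm u"
    have "AE x in (lebesgue :: 'a measure). False"
      using AE_norm
    proof eventually_elim
      case (elim x)
      have "(0::ereal) \<le> ereal \<bar>u x\<bar>" by simp
      with elim neg show ?case by (meson order_trans)
    qed
    then show False using not_AE_False by simp
  qed
  obtain m where m: "Linf_norm u = ereal m" "0 \<le> m"
    using lt ge by (cases "Linf_norm u") auto
  have AE_le: "AE x in lebesgue. \<bar>u x\<bar> \<le> m" using AE_norm by (simp add: m)
  define S where "S = {x. \<bar>u x\<bar> = m}"
  have Sm: "S \<in> sets lebesgue"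
  proof -
    have "{x \<in> space lebesgue. \<bar>u x\<bar> = m} \<in> sets lebesgue" by measurable
    then show ?thesis by (simp add: S_def)
  qed
  have "emeasure lebesgue S \<noteq> 0"
  proof
    assume "emeasure lebesgue S = 0"
    then have "AE x in lebesgue. x \<notin> S"
      by (intro AE_not_in null_setsI Sm)
    with AE_le have less: "AE x in lebesgue. \<bar>u x\<bar> < m"
      by eventually_elim (auto simp: S_def)
    have "0 < m"
    proof (rule ccontr)
      assume "\<not> 0 < m"
      then have "\<not> \<bar>u x\<bar> < m" for x by linarith
      with less have "AE x in (lebesgue :: 'a measure). False" by simp
      then show False using not_AE_False by simp
    qed
    define k where "k j = m * (1 - 1 / real (Suc j))" for j
    have "k \<longlonglongrightarrow> m * (1 - 0)"
      unfolding k_def by (intro tendsto_intros LIMSEQ_Suc[OF lim_1_over_n])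
    then have k_lim: "k \<longlonglongrightarrow> m" by simp
    have "AE x in lebesgue. eventually (\<lambda>j. \<bar>u x\<bar> \<le> k j) sequentially"
      using less
    proof eventually_elim
      case (elim x)
      from order_tendstoD(1)[OF k_lim elim] show ?case
        by (rule eventually_mono) simp
    qed
    moreover have "0 \<le> k j" for j using \<open>0 < m\<close> by (simp add: k_def)
    ultimately obtain j where "AE x in lebesgue. \<bar>u x\<bar> \<le> k j" using descent by blast
    then have "m \<le> k j" using norm_le m(1) by simp
    then show False using \<open>0 < m\<close> by (simp add: k_def field_simps)
  qed
  moreover have "{x. ereal \<bar>u x\<bar> = Linf_norm u} = S" by (simp add: S_def m)
  ultimately show ?thesis using lt by (auto simp: Linf_def zero_less_iff_neq_zero)
qed

end
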